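(* For every $-1<\alpha<0$, \[ \|\mathcal H\|_{A^2_\alpha\to A^2_\alpha}=\mathrm B\!\left(\frac{\alpha+2}{2},1-\frac{\alpha+2}{2}\right)=\frac{\pi}{\sin((\alpha+2)\pi/2)}. \]
   Context: Let $\mathbb D$ be the open unit disk and $dA(z)=\pi^{-1}\,dx\,dy$ normalized area measure. For $\alpha>-1$ put $dA_\alpha(z)=(\alpha+1)(1-|z|^2)^\alpha\,dA(z)$. The weighted Bergman space $A^p_\alpha$ consists of analytic functions $f$ on $\mathbb D$ with $\|f\|_{A^p_\alpha}^p=\int_{\mathbb D}|f|^p\,dA_\alpha<\infty$. The Hilbert matrix operator is, for $f(z)=\sum_{k\ge0}a_kz^k$, \[ \mathcal Hf(z)=\sum_{n=0}^\infty\Big(\sum_{k=0}^\infty\frac{a_k}{n+k+1}\Big)z^n=\int_0^1\frac{f(t)}{1-tz}\,dt, \] (initially for polynomials, which are dense in $A^p_\alpha$), and $\|\mathcal H\|_{A^p_\alpha\to A^p_\alpha}$ denotes its operator norm. $\mathrm B(x,y)=\int_0^1t^{x-1}(1-t)^{y-1}\,dt$ is the beta function. *)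

theory Defs
  imports "HOL-Complex_Analysis.Complex_Analysis"
begin

definition disk_area :: "complex measure" where
  "disk_area = scale_measure (ennreal (1 / pi)) (restrict_space lborel (ball 0 1))"

definition weighted_area :: "real \<Rightarrow> complex measure" where
  "weighted_area \<alpha> =
     density disk_area (\<lambda>z. ennreal ((\<alpha> + 1) * (1 - (cmod z)\<^sup>2) powr \<alpha>))"

text \<open>
  Elements of the space are total functions on the complex plane; only their values on the
  unit disk matter, for membership as well as for the norm.
\<close>

definition bergman_space :: "real \<Rightarrow> real \<Rightarrow> (complex \<Rightarrow> complex) set" where
  "bergman_space p \<alpha> =
     {f. f holomorphic_on ball 0 1 \<and> integrable (weighted_area \<alpha>) (\<lambda>z. cmod (f z) powr p)}"

definition bergman_norm :: "real \<Rightarrow> real \<Rightarrow> (complex \<Rightarrow> complex) \<Rightarrow> real" where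
  "bergman_norm p \<alpha> f = (LINT z|weighted_area \<alpha>. cmod (f z) powr p) powr (1 / p)"

definition taylor_coeff :: "(complex \<Rightarrow> complex) \<Rightarrow> nat \<Rightarrow> complex" where
  "taylor_coeff f k = (deriv ^^ k) f 0 / fact k"

text \<open>
  For \<open>-1 < \<alpha> < 0\<close> the inner series converges absolutely for every \<open>f\<close> in
  \<open>bergman_space 2 \<alpha>\<close> (Cauchy--Schwarz), so the formula makes sense on the whole space and
  not only for polynomials; being bounded there, it is the extension by density from the
  polynomials.
\<close>

definition hilbert_matrix_op :: "(complex \<Rightarrow> complex) \<Rightarrow> complex \<Rightarrow> complex" where
  "hilbert_matrix_op f z =
     (\<Sum>n. (\<Sum>k. taylor_coeff f k / of_nat (n + k + 1)) * z ^ n)"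

definition bounded_operator_on_bergman ::
    "real \<Rightarrow> real \<Rightarrow> ((complex \<Rightarrow> complex) \<Rightarrow> complex \<Rightarrow> complex) \<Rightarrow> bool" where
  "bounded_operator_on_bergman p \<alpha> T \<longleftrightarrow>
     (\<forall>f\<in>bergman_space p \<alpha>. T f \<in> bergman_space p \<alpha>) \<and>
     (\<forall>f\<in>bergman_space p \<alpha>. \<forall>g\<in>bergman_space p \<alpha>. \<forall>z\<in>ball 0 1.
        T (\<lambda>w. f w + g w) z = T f z + T g z) \<and>
     (\<forall>f\<in>bergman_space p \<alpha>. \<forall>c. \<forall>z\<in>ball 0 1. T (\<lambda>w. c * f w) z = c * T f z) \<and>
     (\<exists>C. \<forall>f\<in>bergman_space p \<alpha>. bergman_norm p \<alpha> (T f) \<le> C * bergman_norm p \<alpha> f)"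

text \<open>
  This is a supremum in the reals, hence meaningful only for bounded operators.
\<close>

definition bergman_opnorm ::
    "real \<Rightarrow> real \<Rightarrow> ((complex \<Rightarrow> complex) \<Rightarrow> complex \<Rightarrow> complex) \<Rightarrow> real" where
  "bergman_opnorm p \<alpha> T =
     (SUP f\<in>{f \<in> bergman_space p \<alpha>. bergman_norm p \<alpha> f \<le> 1}. bergman_norm p \<alpha> (T f))"

end

theory Submission
  imports Defs "HOL-Real_Asymp.Real_Asymp"
begin

text \<open>
  Put \<open>s = (\<alpha> + 2) / 2\<close>. By rotation invariance of area the monomials are orthogonal, so
  \<open>A\<^sup>2\<^sub>\<alpha>\<close> is the weighted sequence space with weights
  \<open>w\<^sub>n = n! \<Gamma>(2s) / \<Gamma>(n + 2s)\<close>. The sequences \<open>\<Gamma>(k + t) / k!\<close> are mapped by the Hilbert matrix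
  to \<open>\<Gamma>(t) \<Gamma>(1 - t) n! / \<Gamma>(n + 2 - t)\<close>, and log-convexity of \<open>\<Gamma>\<close> compares image and
  preimage. For \<open>t = s\<close> and \<open>t = 1 - s\<close> this gives the two halves of a Schur test with constant
  \<open>\<Gamma>(s) \<Gamma>(1 - s)\<close>; for \<open>t\<close> increasing to \<open>s\<close> it gives almost extremal sequences, because the
  weighted square sum diverges at \<open>t = s\<close> while the ratio of image and preimage tends to
  \<open>\<Gamma>(t) \<Gamma>(1 - t)\<close> uniformly in \<open>t\<close>.
\<close>

section \<open>Gamma quotients and the Schur test\<close>


text \<open>Sizes explain the exponents. The sequence with parameter t and its image are both of
  order n^(t - 1), and the weights are of order n^(1 - 2 s), so t = s is the borderline at which the
  weighted square sum becomes harmonic. The columns of the Schur test run over weight times image,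
  which has order n^(-s): this is the order of the sequence with parameter 1 - s, and the constant
  is invariant under exchanging s and 1 - s, so rows and columns give the same bound. The condition
  s < 1 makes the sums converge, and s >= 1/2 orders the Gamma arguments in the column estimate. The
  obstacle in the lower bound is that the borderline sequence is not in the space, and that image
  and preimage compare well only from some index on. The terms below a fixed cutoff are lost; this
  loss stays bounded as t tends to s, whereas the remaining sum does not.\<close>

text \<open>The inner arguments \<open>b\<close> and \<open>c\<close> sit at mirrored positions
  between \<open>a\<close> and \<open>d\<close>, so the two chord inequalities for the convex
  function \<open>ln\<close> of \<open>Gamma\<close>, with weights \<open>u\<close> and
  \<open>1 - u\<close>, add up to the claim.\<close>

lemma Gamma_mult_le_of_between:
  fixes a b c d :: real
  assumes "0 < a" "a \<le> b" "b \<le> d" "a + d = b + c"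
  shows "Gamma b * Gamma c \<le> Gamma a * Gamma d"
proof (cases "a = d")
  case True
  then have "b = a" "c = a" using assms by auto
  then show ?thesis using True by simp
next
  case False
  define u where "u = (b - a) / (d - a)"
  have ad: "a < d" using False assms by simp
  have u: "0 \<le> u" "u \<le> 1" using assms ad by (auto simp: u_def field_simps)
  have uu: "u * (d - a) = b - a" using ad by (simp add: u_def)
  have b: "b = (1 - u) * a + u * d" using uu by (simp add: algebra_simps)
  have c: "c = u * a + (1 - u) * d" using uu assms(4) by (simp add: algebra_simps)
  have cv: "convex_on {0<..} (ln \<circ> (Gamma :: real \<Rightarrow> real))" by (rule log_convex_Gamma_real)
  have 1: "ln (Gamma b) \<le> (1 - u) * ln (Gamma a) + u * ln (Gamma d)"
    using convex_onD[OF cv, of u a d] u assms ad b by (simp add: o_def)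
  have 2: "ln (Gamma c) \<le> u * ln (Gamma a) + (1 - u) * ln (Gamma d)"
    using convex_onD[OF cv, of "1 - u" a d] u assms ad c by (simp add: o_def)
  have pos: "Gamma a > 0" "Gamma b > 0" "Gamma c > 0" "Gamma d > 0"
    using assms by (auto intro!: Gamma_real_pos)
  have "ln (Gamma b) + ln (Gamma c) \<le> ln (Gamma a) + ln (Gamma d)"
    using 1 2 by (simp add: algebra_simps)
  then have "ln (Gamma b * Gamma c) \<le> ln (Gamma a * Gamma d)"
    using pos by (simp add: ln_mult)
  then show ?thesis using pos by simp
qed

text \<open>Log-convexity on the interval from \<open>x\<close> to \<open>x + 1\<close>, whose end
  values differ by the factor \<open>x\<close>. All power-type size estimates below come from this
  inequality.\<close>

lemma Gamma_add_le:
  fixes x t :: real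
  assumes "0 < x" "0 \<le> t" "t \<le> 1"
  shows "Gamma (x + t) \<le> Gamma x * x powr t"
proof -
  have pos: "Gamma x > 0" "Gamma (x + t) > 0" using assms by (auto intro!: Gamma_real_pos)
  have cv: "convex_on {0<..} (ln \<circ> (Gamma :: real \<Rightarrow> real))" by (rule log_convex_Gamma_real)
  have eq: "x + t = (1 - t) * x + t * (x + 1)" by (simp add: algebra_simps)
  have "ln (Gamma (x + t)) \<le> (1 - t) * ln (Gamma x) + t * ln (Gamma (x + 1))"
    using convex_onD[OF cv, of t x "x + 1"] assms unfolding eq by (simp add: o_def)
  also have "Gamma (x + 1) = x * Gamma x"
    using assms by (intro Gamma_plus1) (auto elim!: nonpos_Ints_cases)
  also have "(1 - t) * ln (Gamma x) + t * ln (x * Gamma x) = ln (Gamma x * x powr t)"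
    using pos assms by (simp add: ln_mult ln_powr algebra_simps)
  finally show ?thesis using pos assms by simp
qed

lemma Gamma_plus1_real: "0 < x \<Longrightarrow> Gamma (x + 1) = x * Gamma (x :: real)"
  by (intro Gamma_plus1) (auto elim!: nonpos_Ints_cases)

section \<open>Coefficients of (1 - z)^(-x) and their Hilbert transforms\<close>

text \<open>\<open>Gamma x\<close> times the Taylor coefficient of (1 - z)^(-x). Keeping the factor
  \<open>Gamma x\<close> makes the sequence asymptotic to k^(x - 1) with constant 1.\<close>

definition binom_coeff :: "real \<Rightarrow> nat \<Rightarrow> real" where
  "binom_coeff x k = Gamma (real k + x) / fact k"

lemma binom_coeff_pos: "0 < x \<Longrightarrow> 0 < binom_coeff x k"
  by (simp add: binom_coeff_def Gamma_real_pos)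

lemma binom_coeff_Suc:
  assumes "0 < x"
  shows "(real k + 1) * binom_coeff x (Suc k) = (real k + x) * binom_coeff x k"
proof -
  have "Gamma (real (Suc k) + x) = (real k + x) * Gamma (real k + x)"
    using Gamma_plus1_real[of "real k + x"] assms by (simp add: add_ac)
  moreover have "fact (Suc k) = (real k + 1) * fact k" by simp
  ultimately show ?thesis by (simp only: binom_coeff_def) simp
qed

lemma binom_coeff_le:
  assumes "0 < x" "x \<le> 1" "0 < k"
  shows "binom_coeff x k \<le> real k powr (x - 1)"
proof -
  have "Gamma (real k + x) \<le> Gamma (real k) * real k powr x"
    using assms by (intro Gamma_add_le) auto
  moreover have "(fact k :: real) = real k * Gamma (real k)"
    using assms Gamma_fact[of k, where ?'a=real] Gamma_plus1_real[of "real k"] by (simp add: add_ac)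
  moreover have "Gamma (real k) > 0" using assms by (simp add: Gamma_real_pos)
  ultimately show ?thesis using assms
    by (simp add: binom_coeff_def field_simps powr_diff)
qed

lemma binom_coeff_tendsto_0:
  assumes "0 < x" "x < 1"
  shows "binom_coeff x \<longlonglongrightarrow> 0"
proof (rule tendsto_sandwich)
  show "eventually (\<lambda>n. 0 \<le> binom_coeff x n) sequentially"
    using assms binom_coeff_pos[of x] by (simp add: less_imp_le)
  show "eventually (\<lambda>n. binom_coeff x n \<le> real n powr (x - 1)) sequentially"
    using eventually_gt_at_top[of 0] by eventually_elim (use assms in \<open>simp add: binom_coeff_le\<close>)
  show "(\<lambda>n. real n powr (x - 1)) \<longlonglongrightarrow> 0"
    using assms by (intro tendsto_neg_powr filterlim_real_sequentially) auto
qed simp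

text \<open>The value is \<open>Gamma x\<close> times the Beta integral of t^n (1 - t)^(-x) over
  [0, 1], because 1 / (n + k + 1) is the integral of t^(n + k). Instead of exchanging sum and
  integral, the proof establishes the Beta recurrence in \<open>n\<close> for partial sums; the
  boundary terms vanish in the limit because \<open>x < 1\<close>.\<close>

lemma binom_coeff_sums:
  assumes "0 < x" "x < 1"
  shows "(\<lambda>k. binom_coeff x k / (real n + real k + 1)) sums
           (Gamma x * Gamma (1 - x) * (fact n / Gamma (real n + 2 - x)))"
proof (induction n)
  case 0
  have part: "(1 - x) * (\<Sum>k<K. binom_coeff x k / (real k + 1)) = Gamma x - binom_coeff x K" for K
  proof (induction K)
    case (Suc K)
    have "(1 - x) * (binom_coeff x K / (real K + 1)) = binom_coeff x K - binom_coeff x (Suc K)"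
      using binom_coeff_Suc[of x K] assms by (simp add: field_simps)
    then show ?case using Suc by (simp add: algebra_simps)
  qed (simp add: binom_coeff_def)
  have "(\<lambda>K. (Gamma x - binom_coeff x K) / (1 - x)) \<longlonglongrightarrow> (Gamma x - 0) / (1 - x)"
    using assms by (intro tendsto_intros binom_coeff_tendsto_0) auto
  moreover have "(Gamma x - binom_coeff x K) / (1 - x) = (\<Sum>k<K. binom_coeff x k / (real k + 1))" for K
    using part[of K] assms by (simp add: field_simps)
  moreover have "Gamma (2 - x) = (1 - x) * Gamma (1 - x)"
    using Gamma_plus1_real[of "1 - x"] assms by simp
  moreover have "Gamma (1 - x) \<noteq> 0" using assms Gamma_real_pos[of "1 - x"] by linarith
  ultimately show ?case using assms by (simp add: sums_def)
next
  case (Suc n)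
  let ?S = "\<lambda>n K. \<Sum>k<K. binom_coeff x k / (real n + real k + 1)"
  \<comment> \<open>Summation by parts, the discrete form of integrating the Beta integral by parts.
    The last term is the boundary term: a null sequence times a bounded factor.\<close>
  have part: "(real n + 2 - x) * ?S (Suc n) K =
      (real n + 1) * ?S n K - binom_coeff x K * (real K / (real n + real K + 1))" for K
  proof (induction K)
    case (Suc K)
    have *: "binom_coeff x (Suc K) = (real K + x) * binom_coeff x K / (real K + 1)"
      using binom_coeff_Suc[of x K] assms by (simp add: field_simps)
    have "(real n + 2 - x) * (binom_coeff x K / (real (Suc n) + real K + 1)) =
      (real n + 1) * (binom_coeff x K / (real n + real K + 1)) + binom_coeff x K * (real K / (real n + real K + 1))
       - binom_coeff x (Suc K) * (real (Suc K) / (real n + real (Suc K) + 1))"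
      unfolding * by (simp add: divide_simps) (simp add: algebra_simps)
    then show ?case using Suc by (simp add: distrib_left)
  qed simp
  have "(\<lambda>K. real K / (real n + real K + 1)) \<longlonglongrightarrow> 1" by real_asymp
  then have "(\<lambda>K. ((real n + 1) * ?S n K - binom_coeff x K * (real K / (real n + real K + 1))) / (real n + 2 - x))
     \<longlonglongrightarrow> ((real n + 1) * (Gamma x * Gamma (1 - x) * (fact n / Gamma (real n + 2 - x))) - 0 * 1) / (real n + 2 - x)"
    using Suc assms by (intro tendsto_intros binom_coeff_tendsto_0) (auto simp: sums_def)
  moreover have "((real n + 1) * ?S n K - binom_coeff x K * (real K / (real n + real K + 1))) / (real n + 2 - x)
     = ?S (Suc n) K" for K
    by (subst part[symmetric]) (use assms in simp)
  moreover have "Gamma (real (Suc n) + 2 - x) = (real n + 2 - x) * Gamma (real n + 2 - x)"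
    using Gamma_plus1_real[of "real n + 2 - x"] assms by (simp add: algebra_simps)
  ultimately show ?case using assms by (simp add: sums_def add_ac mult_ac)
qed

section \<open>Schur test for the monomial weights\<close>

text \<open>The squared norm of the monomial z^n when \<open>2 * s = \<alpha> + 2\<close>; see
  \<open>nn_integral_disk_measure_power\<close>.\<close>

definition bergman_weight :: "real \<Rightarrow> nat \<Rightarrow> real" where
  "bergman_weight s n = Gamma (2 * s) * fact n / Gamma (real n + 2 * s)"

lemma bergman_weight_pos: "0 < s \<Longrightarrow> 0 < bergman_weight s n"
  by (simp add: bergman_weight_def Gamma_real_pos)

text \<open>Replaces weight times image of \<open>binom_coeff s\<close> by a sequence whose Hilbert
  transform is known in closed form, at the cost of two log-convexity inequalities multiplied
  together.\<close>

lemma bergman_weight_schur_left: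
  assumes "1 / 2 \<le> s" "s < 1"
  shows "bergman_weight s n * (fact n / Gamma (real n + 2 - s)) \<le> Gamma (2 * s) * binom_coeff (1 - s) n"
proof -
  define a b c d f where defs: "a = Gamma (real n + 1 - s)" "b = Gamma (real n + 2 * s)"
    "c = Gamma (real n + 2 - s)" "d = Gamma (real n + s)" "f = (fact n :: real)"
  have f: "f = Gamma (real n + 1)" by (simp add: defs Gamma_fact add_ac)
  have pos: "a > 0" "b > 0" "c > 0" "d > 0" "f > 0"
    using assms by (auto simp: defs intro!: Gamma_real_pos)
  \<comment> \<open>Both pairs of arguments add up to 2 n + 1 + s, and \<open>n + 1\<close>,
    \<open>n + s\<close> lie between \<open>n + 1 - s\<close> and \<open>n + 2 * s\<close> because
    \<open>1 / 2 \<le> s\<close>.\<close>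
  have 1: "f * d \<le> a * b" unfolding f defs using assms
    by (subst mult.commute, intro Gamma_mult_le_of_between) auto
  have 2: "f * f \<le> d * c" unfolding f defs using assms
    by (intro Gamma_mult_le_of_between) auto
  have "f * (f * f) \<le> f * (d * c)" using 2 pos by simp
  also have "\<dots> = (f * d) * c" by simp
  also have "\<dots> \<le> (a * b) * c" using 1 pos by simp
  finally have "f * f / (b * c) \<le> a / f" using pos by (simp add: field_simps)
  moreover have "Gamma (2 * s) > 0" using assms by (auto intro!: Gamma_real_pos)
  ultimately have "Gamma (2 * s) * (f * f / (b * c)) \<le> Gamma (2 * s) * (a / f)" by (intro mult_left_mono) auto
  then show ?thesis by (simp add: defs bergman_weight_def binom_coeff_def add_diff_eq)
qed

text \<open>Closes the column estimate: it returns from the transform of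
  \<open>binom_coeff (1 - s)\<close> to weight times test sequence. The arguments
  \<open>k + 1\<close> and \<open>k + 2 * s\<close> lie between \<open>k + s\<close> and
  \<open>k + 1 + s\<close>, with equal sums.\<close>

lemma bergman_weight_schur_right:
  assumes "1 / 2 \<le> s" "s < 1"
  shows "Gamma (2 * s) * (fact k / Gamma (real k + 1 + s)) \<le> bergman_weight s k * binom_coeff s k"
proof -
  define a b c d where defs: "a = Gamma (real k + 2 * s)" "b = Gamma (real k + s)"
    "c = Gamma (real k + 1 + s)" "d = (fact k :: real)"
  have d: "d = Gamma (real k + 1)" by (simp add: defs Gamma_fact add_ac)
  have pos: "a > 0" "b > 0" "c > 0" "d > 0"
    using assms by (auto simp: defs intro!: Gamma_real_pos)
  have 1: "d * a \<le> b * c" unfolding d defs using assms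
    by (intro Gamma_mult_le_of_between) auto
  then have "d / c \<le> b / a" using pos by (simp add: field_simps)
  moreover have "Gamma (2 * s) > 0" using assms by (auto intro!: Gamma_real_pos)
  ultimately have "Gamma (2 * s) * (d / c) \<le> Gamma (2 * s) * (b / a)" by (intro mult_left_mono) auto
  then show ?thesis by (simp add: defs bergman_weight_def binom_coeff_def)
qed

text \<open>The Schur test with \<open>u\<close> for the rows and \<open>v\<close> for the columns.
  Finite sections avoid all questions of convergence; \<open>hilbert_matrix_bounded\<close> takes
  the limits.\<close>

lemma hilbert_matrix_upper_bound:
  fixes A :: "nat \<Rightarrow> real"
  assumes s: "1 / 2 \<le> s" "s < 1"
  shows "(\<Sum>n<N. bergman_weight s n * (\<Sum>k<K. A k / (real n + real k + 1))\<^sup>2)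
           \<le> (Gamma s * Gamma (1 - s))\<^sup>2 * (\<Sum>k<K. (A k)\<^sup>2 * bergman_weight s k)"
proof -
  define C where "C = Gamma s * Gamma (1 - s)"
  define u where "u = binom_coeff s"
  define v where "v n = fact n / Gamma (real n + 2 - s)" for n
  let ?w = "bergman_weight s"
  have Cpos: "C > 0" using s by (simp add: C_def Gamma_real_pos)
  have upos: "u k > 0" for k using s by (simp add: u_def binom_coeff_pos)
  have wpos: "?w k > 0" for k using s by (simp add: bergman_weight_pos)
  have vpos: "v n > 0" for n using s by (auto simp: v_def intro!: divide_pos_pos Gamma_real_pos)
  have F1: "(\<Sum>k<K. u k / (real n + real k + 1)) \<le> C * v n" for n
  proof -
    have sm: "(\<lambda>k. u k / (real n + real k + 1)) sums (C * v n)"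
      using binom_coeff_sums[of s n] s by (simp add: u_def v_def C_def)
    show ?thesis
      using sum_le_suminf[OF sums_summable[OF sm], of "{..<K}"] sums_unique[OF sm] upos
      by (simp add: less_imp_le)
  qed
  \<comment> \<open>Column bound: pass to the sequence for \<open>1 - s\<close>, sum it exactly, and
    compare back.\<close>
  have F2: "(\<Sum>n<N. ?w n * v n / (real n + real k + 1)) \<le> C * (?w k * u k)" for k
  proof -
    let ?b = "binom_coeff (1 - s)"
    have sm: "(\<lambda>n. ?b n / (real k + real n + 1)) sums (C * (fact k / Gamma (real k + 1 + s)))"
      using binom_coeff_sums[of "1 - s" k] s by (simp add: C_def algebra_simps)
    have G: "Gamma (2 * s) > 0" using s by (auto intro!: Gamma_real_pos)
    have "(\<Sum>n<N. ?w n * v n / (real n + real k + 1))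
        \<le> (\<Sum>n<N. Gamma (2 * s) * ?b n / (real n + real k + 1))"
      using bergman_weight_schur_left[OF s] by (intro sum_mono divide_right_mono) (auto simp: v_def)
    also have "\<dots> = Gamma (2 * s) * (\<Sum>n<N. ?b n / (real k + real n + 1))"
      by (simp add: sum_distrib_left add_ac)
    also have "\<dots> \<le> Gamma (2 * s) * (C * (fact k / Gamma (real k + 1 + s)))"
      using sum_le_suminf[OF sums_summable[OF sm], of "{..<N}"] sums_unique[OF sm]
        binom_coeff_pos[of "1 - s"] s G
      by (simp add: less_imp_le)
    also have "\<dots> = C * (Gamma (2 * s) * (fact k / Gamma (real k + 1 + s)))" by simp
    also have "\<dots> \<le> C * (?w k * u k)"
      using bergman_weight_schur_right[OF s, of k] Cpos by (intro mult_left_mono) (auto simp: u_def)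
    finally show ?thesis .
  qed
  have row: "(\<Sum>k<K. A k / (real n + real k + 1))\<^sup>2
      \<le> C * v n * (\<Sum>k<K. (A k)\<^sup>2 / (u k * (real n + real k + 1)))" for n
  proof -
    let ?m = "\<lambda>k. real n + real k + 1"
    have m: "?m k > 0" for k by simp
    \<comment> \<open>The splitting for Cauchy-Schwarz: the squares of the first factors add up to
      the row sum of \<open>u\<close>, which \<open>F1\<close> controls.\<close>
    have eq: "A k / ?m k = sqrt (u k / ?m k) * (A k / sqrt (u k * ?m k))" for k
    proof -
      have "sqrt (u k / ?m k) / sqrt (u k * ?m k) = sqrt ((u k / ?m k) / (u k * ?m k))"
        by (simp only: real_sqrt_divide)
      also have "(u k / ?m k) / (u k * ?m k) = (1 / ?m k)\<^sup>2"
        using upos[of k] by (simp add: power2_eq_square)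
      also have "sqrt \<dots> = 1 / ?m k" using m[of k] by simp
      finally have "A k * (sqrt (u k / ?m k) / sqrt (u k * ?m k)) = A k * (1 / ?m k)" by (rule arg_cong)
      then show ?thesis by (simp add: mult.commute)
    qed
    have "(\<Sum>k<K. A k / ?m k)\<^sup>2 = (\<Sum>k<K. sqrt (u k / ?m k) * (A k / sqrt (u k * ?m k)))\<^sup>2"
      by (simp only: eq[symmetric])
    also have "\<dots> \<le> (\<Sum>k<K. (sqrt (u k / ?m k))\<^sup>2) * (\<Sum>k<K. (A k / sqrt (u k * ?m k))\<^sup>2)"
      by (rule Cauchy_Schwarz_ineq_sum)
    also have "\<dots> = (\<Sum>k<K. u k / ?m k) * (\<Sum>k<K. (A k)\<^sup>2 / (u k * ?m k))"
      using upos m by (simp add: power_divide less_imp_le)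
    also have "\<dots> \<le> C * v n * (\<Sum>k<K. (A k)\<^sup>2 / (u k * ?m k))"
      using F1 upos by (intro mult_right_mono sum_nonneg) (auto simp: less_imp_le)
    finally show ?thesis .
  qed
  have "(\<Sum>n<N. ?w n * (\<Sum>k<K. A k / (real n + real k + 1))\<^sup>2)
      \<le> (\<Sum>n<N. ?w n * (C * v n * (\<Sum>k<K. (A k)\<^sup>2 / (u k * (real n + real k + 1)))))"
    using row wpos by (intro sum_mono mult_left_mono) (auto simp: less_imp_le)
  also have "\<dots> = (\<Sum>n<N. \<Sum>k<K. C * ((A k)\<^sup>2 / u k) * (?w n * v n / (real n + real k + 1)))"
    by (simp add: sum_distrib_left divide_simps mult_ac)
  also have "\<dots> = (\<Sum>k<K. C * ((A k)\<^sup>2 / u k) * (\<Sum>n<N. ?w n * v n / (real n + real k + 1)))"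
    by (subst sum.swap) (simp add: sum_distrib_left)
  also have "\<dots> \<le> (\<Sum>k<K. C * ((A k)\<^sup>2 / u k) * (C * (?w k * u k)))"
    using F2 Cpos upos by (intro sum_mono mult_left_mono) (auto simp: less_imp_le)
  also have "\<dots> = C\<^sup>2 * (\<Sum>k<K. (A k)\<^sup>2 * ?w k)"
    unfolding sum_distrib_left
  proof (intro sum.cong refl)
    fix k show "C * ((A k)\<^sup>2 / u k) * (C * (?w k * u k)) = C\<^sup>2 * ((A k)\<^sup>2 * ?w k)"
      using upos[of k] by (simp add: field_simps power2_eq_square)
  qed
  finally show ?thesis by (simp add: C_def)
qed

section \<open>Almost extremal sequences\<close>


text \<open>\<open>(k + 1) * fact k\<close> is \<open>Gamma (k + 2)\<close>, and the step from
  \<open>k + 2 * s\<close> to \<open>k + 2\<close> has length at most 1 since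
  \<open>1 / 2 \<le> s\<close>, so \<open>Gamma_add_le\<close> applies.\<close>

lemma bergman_weight_le:
  assumes "1 / 2 \<le> s" "s < 1"
  shows "bergman_weight s k \<le> Gamma (2 * s) * (real k + 2) powr (2 - 2 * s) / (real k + 1)"
proof -
  define g where "g = Gamma (real k + 2 * s)"
  have g: "g > 0" using assms by (auto simp: g_def intro!: Gamma_real_pos)
  have "(real k + 1) * fact k = Gamma (real k + 2)"
    using Gamma_fact[of "Suc k", where ?'a=real] by (simp add: add_ac)
  also have "real k + 2 = (real k + 2 * s) + (2 - 2 * s)" by simp
  also have "Gamma \<dots> \<le> g * (real k + 2 * s) powr (2 - 2 * s)"
    unfolding g_def using assms by (intro Gamma_add_le) auto
  also have "\<dots> \<le> g * (real k + 2) powr (2 - 2 * s)"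
    using g assms by (intro mult_left_mono powr_mono2) auto
  finally have "fact k / g \<le> (real k + 2) powr (2 - 2 * s) / (real k + 1)"
    using g by (simp add: field_simps)
  moreover have "Gamma (2 * s) > 0" using assms by (auto intro!: Gamma_real_pos)
  ultimately have "Gamma (2 * s) * (fact k / g) \<le> Gamma (2 * s) * ((real k + 2) powr (2 - 2 * s) / (real k + 1))"
    by (intro mult_left_mono) auto
  then show ?thesis by (simp add: bergman_weight_def g_def)
qed

text \<open>The terms have order k^(2 t - 2) k^(1 - 2 s), and the total exponent is below -1 because
  \<open>t < s\<close>.\<close>

lemma summable_binom_coeff_weight:
  assumes s: "1 / 2 \<le> s" "s < 1" and t: "0 < t" "t < s"
  shows "summable (\<lambda>k. (binom_coeff t k)\<^sup>2 * bergman_weight s k)"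
proof (rule summable_comparison_test_ev)
  define G where "G = Gamma (2 * s)"
  have G: "G > 0" using s by (auto simp: G_def intro!: Gamma_real_pos)
  show "summable (\<lambda>k. 9 * G * real k powr (2 * t - 2 * s - 1))"
    using t by (intro summable_mult) (simp add: summable_real_powr_iff)
  show "eventually (\<lambda>k. norm ((binom_coeff t k)\<^sup>2 * bergman_weight s k)
          \<le> 9 * G * real k powr (2 * t - 2 * s - 1)) sequentially"
    using eventually_gt_at_top[of 0]
  proof eventually_elim
    case (elim k)
    have k: "real k \<ge> 1" using elim by simp
    have b: "0 \<le> binom_coeff t k" "binom_coeff t k \<le> real k powr (t - 1)"
      using binom_coeff_pos[of t k] binom_coeff_le[of t k] s t elim by auto
    have "(binom_coeff t k)\<^sup>2 \<le> (real k powr (t - 1))\<^sup>2"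
      using b by (intro power_mono) auto
    also have "\<dots> = real k powr (2 * t - 2)"
      using k by (simp add: power2_eq_square powr_add[symmetric])
    finally have 1: "(binom_coeff t k)\<^sup>2 \<le> real k powr (2 * t - 2)" .
    \<comment> \<open>For \<open>k \<ge> 1\<close> the base is at most \<open>3 * k\<close>, and
      3^(2 - 2 s) is at most 9: the origin of the constant 9.\<close>
    have "(real k + 2) powr (2 - 2 * s) \<le> (3 * real k) powr (2 - 2 * s)"
      using k s by (intro powr_mono2) auto
    also have "\<dots> = 3 powr (2 - 2 * s) * real k powr (2 - 2 * s)"
      using k by (simp add: powr_mult)
    also have "\<dots> \<le> 3 powr 2 * real k powr (2 - 2 * s)"
      using s by (intro mult_right_mono powr_mono) auto
    finally have "(real k + 2) powr (2 - 2 * s) \<le> 9 * real k powr (2 - 2 * s)" by simp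
    then have "G * (real k + 2) powr (2 - 2 * s) / (real k + 1) \<le> G * (9 * real k powr (2 - 2 * s)) / real k"
      using G k by (intro frac_le mult_left_mono) auto
    also have "\<dots> = 9 * G * real k powr (1 - 2 * s)"
      using k by (simp add: powr_diff powr_add field_simps power2_eq_square)
    finally have 2: "bergman_weight s k \<le> 9 * G * real k powr (1 - 2 * s)"
      using bergman_weight_le[OF s, of k] by (simp add: G_def)
    have "(binom_coeff t k)\<^sup>2 * bergman_weight s k
        \<le> real k powr (2 * t - 2) * (9 * G * real k powr (1 - 2 * s))"
      using 1 2 bergman_weight_pos[of s k] s by (intro mult_mono) auto
    also have "\<dots> = 9 * G * (real k powr (2 * t - 2) * real k powr (1 - 2 * s))" by simp
    also have "real k powr (2 * t - 2) * real k powr (1 - 2 * s) = real k powr (2 * t - 2 * s - 1)"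
      by (simp add: powr_add[symmetric] algebra_simps)
    finally show ?case using bergman_weight_pos[of s k] s by simp
  qed
qed

text \<open>At parameter \<open>s\<close> the total exponent is exactly -1. The powers of
  \<open>k + 1\<close> from the two Gamma estimates combine to a first power, which leaves a
  multiple of the harmonic series as a lower bound.\<close>

lemma not_summable_binom_coeff_weight:
  assumes s: "1 / 2 \<le> s" "s < 1"
  shows "\<not> summable (\<lambda>k. (binom_coeff s k)\<^sup>2 * bergman_weight s k)"
proof
  define G where "G = Gamma (2 * s)"
  have G: "G > 0" using s by (auto simp: G_def intro!: Gamma_real_pos)
  have le: "G / (real k + 1) \<le> (binom_coeff s k)\<^sup>2 * bergman_weight s k" for k
  proof -
    define F g h where "F = (fact k :: real)" and "g = Gamma (real k + s)" and "h = Gamma (real k + 2 * s)"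
    let ?x = "real k + 1"
    have F: "Gamma ?x = F" by (simp add: F_def Gamma_fact add_ac)
    have pos: "F > 0" "g > 0" "h > 0" using s by (auto simp: F_def g_def h_def intro!: Gamma_real_pos)
    have "h = Gamma (?x + (2 * s - 1))" by (simp add: h_def)
    also have "\<dots> \<le> F * ?x powr (2 * s - 1)"
      using s unfolding F[symmetric] by (intro Gamma_add_le) auto
    finally have h: "h \<le> F * ?x powr (2 * s - 1)" .
    have "F = Gamma ((real k + s) + (1 - s))" by (simp add: F[symmetric])
    also have "\<dots> \<le> g * (real k + s) powr (1 - s)"
      using s unfolding g_def by (intro Gamma_add_le) auto
    also have "\<dots> \<le> g * ?x powr (1 - s)"
      using s pos by (intro mult_left_mono powr_mono2) auto
    finally have "F\<^sup>2 \<le> (g * ?x powr (1 - s))\<^sup>2" using pos by (intro power_mono) auto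
    also have "\<dots> = g\<^sup>2 * ?x powr (2 - 2 * s)"
      by (simp add: power_mult_distrib power2_eq_square powr_add[symmetric])
    finally have g: "F\<^sup>2 \<le> g\<^sup>2 * ?x powr (2 - 2 * s)" .
    have "F * h \<le> F\<^sup>2 * ?x powr (2 * s - 1)"
      using h pos by (simp add: power2_eq_square)
    also have "\<dots> \<le> (g\<^sup>2 * ?x powr (2 - 2 * s)) * ?x powr (2 * s - 1)"
      using g by (intro mult_right_mono) auto
    also have "\<dots> = g\<^sup>2 * (?x powr (2 - 2 * s) * ?x powr (2 * s - 1))" by simp
    also have "\<dots> = g\<^sup>2 * ?x"
      by (simp add: powr_add[symmetric])
    finally have "1 / ?x \<le> (g / F)\<^sup>2 * (F / h)"
      using pos by (simp add: field_simps power2_eq_square)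
    then have "G * (1 / ?x) \<le> G * ((g / F)\<^sup>2 * (F / h))"
      using G by (intro mult_left_mono) auto
    then show ?thesis by (simp add: bergman_weight_def binom_coeff_def F_def g_def h_def G_def mult_ac)
  qed
  assume "summable (\<lambda>k. (binom_coeff s k)\<^sup>2 * bergman_weight s k)"
  then have "summable (\<lambda>k. G / (real k + 1))"
    by (rule summable_comparison_test'[where N = 0]) (use le G in auto)
  then have "summable (\<lambda>k. inverse G * (G / (real k + 1)))" by (rule summable_mult)
  then have "summable (\<lambda>k. inverse (real (Suc k)))" using G by (simp add: field_simps)
  then show False using not_summable_harmonic[where ?'a = real] summable_Suc_iff[of "\<lambda>k. inverse (real k)"] by simp
qed

text \<open>The correction n / (n + 1) is free of \<open>t\<close>, which later permits one cutoff
  index for all \<open>t\<close> near \<open>s\<close>. It arises because \<open>g\<close> is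
  bounded with exponent \<open>t\<close> and \<open>h\<close> with exponent \<open>1 - t\<close>,
  and the exponents add up to 1.\<close>

lemma hilbert_matrix_binom_coeff_ge:
  assumes t: "0 < t" "t < 1"
  shows "Gamma t * Gamma (1 - t) * (real n / (real n + 1)) * binom_coeff t n
           \<le> (\<Sum>k. binom_coeff t k / (real n + real k + 1))"
proof (cases "n = 0")
  case True
  have "summable (\<lambda>k. binom_coeff t k / (real n + real k + 1))"
    using binom_coeff_sums[OF t, of n] by (rule sums_summable)
  then show ?thesis using binom_coeff_pos[OF t(1)] True
    by (auto intro!: suminf_nonneg simp: less_imp_le)
next
  case False
  define F g h where "F = (fact n :: real)" and "g = Gamma (real n + t)" and "h = Gamma (real n + 2 - t)"
  have pos: "F > 0" "g > 0" "h > 0" using t by (auto simp: F_def g_def h_def intro!: Gamma_real_pos)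
  have F: "Gamma (real n + 1) = F" by (simp add: F_def Gamma_fact add_ac)
  have F': "F = real n * Gamma (real n)" using Gamma_plus1_real[of "real n"] False by (simp add: F)
  have "real n + 2 - t = (real n + 1) + (1 - t)" by simp
  then have "h = Gamma ((real n + 1) + (1 - t))" by (simp only: h_def)
  also have "\<dots> \<le> F * (real n + 1) powr (1 - t)"
    using t unfolding F[symmetric] by (intro Gamma_add_le) auto
  finally have h: "h \<le> F * (real n + 1) powr (1 - t)" .
  have "g \<le> Gamma (real n) * real n powr t"
    using t False unfolding g_def by (intro Gamma_add_le) auto
  also have "\<dots> \<le> Gamma (real n) * (real n + 1) powr t"
    using t False by (intro mult_left_mono powr_mono2) (auto simp: Gamma_real_pos less_imp_le)
  finally have "real n * g \<le> F * (real n + 1) powr t" using False by (simp add: F')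
  then have "real n * g * h \<le> (F * (real n + 1) powr t) * (F * (real n + 1) powr (1 - t))"
    by (rule mult_mono) (use h pos in auto)
  also have "\<dots> = F\<^sup>2 * ((real n + 1) powr t * (real n + 1) powr (1 - t))"
    by (simp add: power2_eq_square)
  also have "\<dots> = F\<^sup>2 * (real n + 1)" by (simp add: powr_add[symmetric])
  finally have "real n / (real n + 1) * g * h \<le> F * F"
    by (simp add: pos_divide_le_eq power2_eq_square mult_ac)
  then have "real n / (real n + 1) * g \<le> F * F / h"
    using pos by (simp only: pos_le_divide_eq)
  then have "real n / (real n + 1) * g / F \<le> F / h"
    using pos by (simp only: pos_divide_le_eq) simp
  then have "real n / (real n + 1) * (g / F) \<le> F / h" by simp
  then have "(Gamma t * Gamma (1 - t)) * (real n / (real n + 1) * (g / F)) \<le> (Gamma t * Gamma (1 - t)) * (F / h)"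
    using t by (intro mult_left_mono) (auto simp: Gamma_real_pos less_imp_le)
  then show ?thesis
    using sums_unique[OF binom_coeff_sums[OF t, of n]]
    by (simp add: binom_coeff_def F_def g_def h_def mult_ac)
qed

text \<open>An absorption argument. If \<open>M\<close> were too small, the image would exceed
  \<open>M\<close> times the preimage from some index \<open>m\<close> on. For \<open>t < s\<close>
  the tail can be cancelled on both sides, so that it is bounded in terms of the first
  \<open>m\<close> summands. That bound survives the limit to \<open>s\<close> and contradicts the
  divergence there.\<close>

lemma hilbert_matrix_lower_bound:
  assumes s: "1 / 2 \<le> s" "s < 1" and "0 \<le> M"
    and bound: "\<And>A N. (\<And>k. 0 \<le> A k) \<Longrightarrow> summable (\<lambda>k. (A k)\<^sup>2 * bergman_weight s k) \<Longrightarrow>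
      (\<Sum>n<N. bergman_weight s n * (\<Sum>k. A k / (real n + real k + 1))\<^sup>2)
         \<le> M\<^sup>2 * (\<Sum>k. (A k)\<^sup>2 * bergman_weight s k)"
  shows "Gamma s * Gamma (1 - s) \<le> M"
proof (rule ccontr)
  assume "\<not> ?thesis"
  then have less: "M < Gamma s * Gamma (1 - s) * 1" by simp
  let ?w = "bergman_weight s"
  have w: "?w n > 0" for n using s by (simp add: bergman_weight_pos)
  have "(\<lambda>n. real n / (real n + 1)) \<longlonglongrightarrow> 1" by real_asymp
  then have "(\<lambda>n. Gamma s * Gamma (1 - s) * (real n / (real n + 1))) \<longlonglongrightarrow> Gamma s * Gamma (1 - s) * 1"
    by (intro tendsto_intros)
  then have "eventually (\<lambda>n. M < Gamma s * Gamma (1 - s) * (real n / (real n + 1))) sequentially"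
    using less by (rule order_tendstoD(1))
  then obtain m where m: "M < Gamma s * Gamma (1 - s) * (real m / (real m + 1))"
    by (auto simp: eventually_at_top_linorder)
  \<comment> \<open>The gain per unit of tail mass. It is known to be positive only at
    \<open>s\<close>, hence the separate trivial case of negative \<open>D t\<close> in
    \<open>key\<close>.\<close>
  define D where "D t = (Gamma t * Gamma (1 - t) * (real m / (real m + 1)))\<^sup>2 - M\<^sup>2" for t
  define a where "a t k = (binom_coeff t k)\<^sup>2 * ?w k" for t k
  have Ds: "D s > 0" using power_strict_mono[OF m \<open>0 \<le> M\<close>, of 2] by (simp add: D_def)
  have a0: "a t k \<ge> 0" for t k using w[of k] by (simp add: a_def)
  have key: "D t * (\<Sum>k=m..<K. a t k) \<le> M\<^sup>2 * (\<Sum>k<m. a t k)" if t: "0 < t" "t < s" for t K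
  proof (cases "D t \<ge> 0")
    case False
    then have "D t * (\<Sum>k=m..<K. a t k) \<le> 0"
      using a0 by (intro mult_nonpos_nonneg sum_nonneg) auto
    also have "\<dots> \<le> M\<^sup>2 * (\<Sum>k<m. a t k)" using a0 by (intro mult_nonneg_nonneg sum_nonneg) auto
    finally show ?thesis .
  next
    case True
    have t1: "t < 1" using t s by simp
    have sm': "summable (\<lambda>k. (binom_coeff t k)\<^sup>2 * ?w k)"
      by (rule summable_binom_coeff_weight) (use s t in auto)
    moreover have "a t = (\<lambda>k. (binom_coeff t k)\<^sup>2 * ?w k)" by (simp add: a_def fun_eq_iff)
    ultimately have sm: "summable (a t)" by simp
    define S where "S = (\<Sum>k. a t k)"
    define P where "P = (\<Sum>k<m. a t k)"
    have partial: "(D t + M\<^sup>2) * (\<Sum>k=m..<K. a t k) \<le> M\<^sup>2 * S" for K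
    proof -
      have "(D t + M\<^sup>2) * (\<Sum>k=m..<K. a t k)
          \<le> (\<Sum>n=m..<K. ?w n * (\<Sum>k. binom_coeff t k / (real n + real k + 1))\<^sup>2)"
        unfolding sum_distrib_left
      proof (intro sum_mono)
        fix n assume n: "n \<in> {m..<K}"
        let ?C = "Gamma t * Gamma (1 - t)"
        have C: "?C > 0" using t t1 by (simp add: Gamma_real_pos)
        have "?C * (real m / (real m + 1)) * binom_coeff t n \<le> ?C * (real n / (real n + 1)) * binom_coeff t n"
          using C binom_coeff_pos[OF t(1), of n] n
          by (intro mult_right_mono mult_left_mono) (auto simp: field_simps)
        also have "\<dots> \<le> (\<Sum>k. binom_coeff t k / (real n + real k + 1))"
          by (rule hilbert_matrix_binom_coeff_ge[OF t(1) t1])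
        finally have "(?C * (real m / (real m + 1)) * binom_coeff t n)\<^sup>2
            \<le> (\<Sum>k. binom_coeff t k / (real n + real k + 1))\<^sup>2"
          using C binom_coeff_pos[OF t(1), of n] by (intro power_mono) auto
        then have "(?C * (real m / (real m + 1)) * binom_coeff t n)\<^sup>2 * ?w n
            \<le> (\<Sum>k. binom_coeff t k / (real n + real k + 1))\<^sup>2 * ?w n"
          using w[of n] by (intro mult_right_mono) auto
        then show "(D t + M\<^sup>2) * a t n \<le> ?w n * (\<Sum>k. binom_coeff t k / (real n + real k + 1))\<^sup>2"
          by (simp only: D_def a_def power_mult_distrib) (simp add: mult_ac)
      qed
      also have "\<dots> \<le> (\<Sum>n<K. ?w n * (\<Sum>k. binom_coeff t k / (real n + real k + 1))\<^sup>2)"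
        using w by (intro sum_mono2) (auto simp: less_imp_le)
      also have "\<dots> \<le> M\<^sup>2 * S"
        using bound[of "binom_coeff t" K] sm' binom_coeff_pos[OF t(1)]
        by (simp add: S_def a_def less_imp_le)
      finally show ?thesis .
    qed
    \<comment> \<open>The tail \<open>S - P\<close> appears on both sides and is cancelled, leaving
      only \<open>P\<close> on the right. This needs \<open>S\<close> to be a genuine finite sum,
      which is why \<open>t\<close> stays below \<open>s\<close>.\<close>
    have "(\<lambda>K. (D t + M\<^sup>2) * ((\<Sum>k<K. a t k) - P)) \<longlonglongrightarrow> (D t + M\<^sup>2) * (S - P)"
      using summable_LIMSEQ[OF sm] by (intro tendsto_intros) (simp add: S_def)
    moreover have "eventually (\<lambda>K. (D t + M\<^sup>2) * ((\<Sum>k<K. a t k) - P) \<le> M\<^sup>2 * S) sequentially"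
      using eventually_ge_at_top[of m]
    proof eventually_elim
      case (elim K)
      have "(\<Sum>k<K. a t k) = P + (\<Sum>k=m..<K. a t k)"
        using sum.atLeastLessThan_concat[of 0 m K "a t"] elim by (simp add: P_def lessThan_atLeast0)
      then show ?case using partial[of K] by simp
    qed
    ultimately have "(D t + M\<^sup>2) * (S - P) \<le> M\<^sup>2 * S"
      by (intro tendsto_upperbound) auto
    then have le: "D t * (S - P) \<le> M\<^sup>2 * P" by (simp add: algebra_simps)
    have "(\<Sum>k=m..<K. a t k) + P = sum a' ({m..<K} \<union> {..<m})" if "a' = a t" for a'
      unfolding P_def that by (rule sum.union_disjoint[symmetric]) auto
    moreover have "sum (a t) ({m..<K} \<union> {..<m}) \<le> S"
      unfolding S_def by (rule sum_le_suminf[OF sm]) (use a0 in auto)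
    ultimately have "(\<Sum>k=m..<K. a t k) \<le> S - P" by simp
    then have "D t * (\<Sum>k=m..<K. a t k) \<le> D t * (S - P)" using True by (intro mult_left_mono)
    then show ?thesis using le by (simp add: P_def)
  qed
  \<comment> \<open>\<open>K\<close> is fixed while \<open>t\<close> tends to \<open>s\<close> from
    the left, so only continuity of finite sums is involved.\<close>
  have lim: "D s * (\<Sum>k=m..<K. a s k) \<le> M\<^sup>2 * (\<Sum>k<m. a s k)" for K
  proof (rule tendsto_le)
    have nz: "x > 0 \<Longrightarrow> x \<notin> \<int>\<^sub>\<le>\<^sub>0" for x :: real by (auto elim!: nonpos_Ints_cases)
    have id: "((\<lambda>t. t) \<longlongrightarrow> s) (at_left s)" by (rule tendsto_ident_at)
    have ta: "((\<lambda>t. a t k) \<longlongrightarrow> a s k) (at_left s)" for k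
      unfolding a_def binom_coeff_def using s by (intro tendsto_intros id nz) auto
    have tD: "(D \<longlongrightarrow> D s) (at_left s)"
      unfolding D_def using s by (intro tendsto_intros id nz) auto
    show "((\<lambda>t. M\<^sup>2 * (\<Sum>k<m. a t k)) \<longlongrightarrow> M\<^sup>2 * (\<Sum>k<m. a s k)) (at_left s)"
      by (intro tendsto_intros ta)
    show "((\<lambda>t. D t * (\<Sum>k=m..<K. a t k)) \<longlongrightarrow> D s * (\<Sum>k=m..<K. a s k)) (at_left s)"
      by (intro tendsto_intros ta tD)
    have "eventually (\<lambda>t. t \<in> {0<..<s}) (at_left s)"
      using s by (intro eventually_at_leftI[of 0]) auto
    then show "eventually (\<lambda>t. D t * (\<Sum>k=m..<K. a t k) \<le> M\<^sup>2 * (\<Sum>k<m. a t k)) (at_left s)"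
      by eventually_elim (use key in auto)
  qed simp
  have "summable (a s)"
  proof (rule bounded_imp_summable)
    fix K
    show "(\<Sum>k\<le>K. a s k) \<le> (\<Sum>k<m. a s k) + M\<^sup>2 * (\<Sum>k<m. a s k) / D s"
    proof -
      have "(\<Sum>k\<le>K. a s k) \<le> sum (a s) ({..<m} \<union> {m..<Suc K})"
        using a0 by (intro sum_mono2) auto
      also have "\<dots> = (\<Sum>k<m. a s k) + (\<Sum>k=m..<Suc K. a s k)"
        by (rule sum.union_disjoint) auto
      also have "(\<Sum>k=m..<Suc K. a s k) \<le> M\<^sup>2 * (\<Sum>k<m. a s k) / D s"
        using lim[of "Suc K"] Ds by (simp add: pos_le_divide_eq mult.commute)
      finally show ?thesis by simp
    qed
  qed (rule a0)
  moreover have "a s = (\<lambda>k. (binom_coeff s k)\<^sup>2 * ?w k)" by (simp add: a_def fun_eq_iff)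
  ultimately show False using not_summable_binom_coeff_weight[OF s] by simp
qed

section \<open>Rotation invariance and radial distribution of area\<close>


text \<open>Lebesgue measure is determined by its values on boxes, and boxes of the plane are
  products of intervals. This makes Tonelli available for real and imaginary parts.\<close>

lemma distr_lborel_pair_Complex:
  "distr (lborel \<Otimes>\<^sub>M lborel) borel (\<lambda>p. Complex (fst p) (snd p)) = (lborel :: complex measure)"
proof (rule lborel_eqI[symmetric])
  have meas: "(\<lambda>p. Complex (fst p) (snd p)) \<in> borel_measurable (lborel \<Otimes>\<^sub>M lborel)"
    unfolding Complex_eq by measurable
  fix l u :: complex
  assume lu: "\<And>b. b \<in> Basis \<Longrightarrow> l \<bullet> b \<le> u \<bullet> b"
  then have le: "Re l \<le> Re u" "Im l \<le> Im u"
    using lu[of 1] lu[of \<i>] by (auto simp: inner_complex_def)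
  have "(\<lambda>p. Complex (fst p) (snd p)) -` box l u \<inter> space (lborel \<Otimes>\<^sub>M lborel)
      = {Re l<..<Re u} \<times> {Im l<..<Im u}"
    by (auto simp: box_def Basis_complex_def inner_complex_def space_pair_measure)
  then show "emeasure (distr (lborel \<Otimes>\<^sub>M lborel) borel (\<lambda>p. Complex (fst p) (snd p))) (box l u)
      = ennreal (\<Prod>b\<in>Basis. (u - l) \<bullet> b)"
    using le meas
    by (simp add: emeasure_distr lborel.emeasure_pair_measure_Times Basis_complex_def
        inner_complex_def ennreal_mult)
qed simp

lemma nn_integral_lborel_Complex:
  fixes f :: "complex \<Rightarrow> ennreal"
  assumes [measurable]: "f \<in> borel_measurable borel"
  shows "(\<integral>\<^sup>+z. f z \<partial>lborel) = (\<integral>\<^sup>+x. \<integral>\<^sup>+y. f (Complex x y) \<partial>lborel \<partial>lborel)"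
    and "(\<integral>\<^sup>+z. f z \<partial>lborel) = (\<integral>\<^sup>+y. \<integral>\<^sup>+x. f (Complex x y) \<partial>lborel \<partial>lborel)"
proof -
  have meas[measurable]: "(\<lambda>p. Complex (fst p) (snd p)) \<in> borel_measurable (lborel \<Otimes>\<^sub>M lborel)"
    unfolding Complex_eq by measurable
  have "(\<integral>\<^sup>+z. f z \<partial>lborel) = (\<integral>\<^sup>+p. f (Complex (fst p) (snd p)) \<partial>(lborel \<Otimes>\<^sub>M lborel))"
    by (subst distr_lborel_pair_Complex[symmetric]) (simp add: nn_integral_distr)
  moreover have "(\<lambda>p. f (Complex (fst p) (snd p))) \<in> borel_measurable (lborel \<Otimes>\<^sub>M lborel)"
    by measurable
  note lborel.nn_integral_fst[OF this] lborel_pair.nn_integral_snd[OF this]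
  ultimately show "(\<integral>\<^sup>+z. f z \<partial>lborel) = (\<integral>\<^sup>+x. \<integral>\<^sup>+y. f (Complex x y) \<partial>lborel \<partial>lborel)"
    and "(\<integral>\<^sup>+z. f z \<partial>lborel) = (\<integral>\<^sup>+y. \<integral>\<^sup>+x. f (Complex x y) \<partial>lborel \<partial>lborel)"
    by simp_all
qed

text \<open>On each horizontal line the shear is a translation.\<close>

lemma nn_integral_shear_Re:
  assumes [measurable]: "f \<in> borel_measurable borel"
  shows "(\<integral>\<^sup>+z. f (z + of_real (t * Im z)) \<partial>lborel) = (\<integral>\<^sup>+z. f z \<partial>lborel)"
proof -
  have [measurable]: "(\<lambda>x. f (Complex x y)) \<in> borel_measurable borel" for y
    unfolding Complex_eq by measurable
  have "(\<integral>\<^sup>+z. f (z + of_real (t * Im z)) \<partial>lborel)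
      = (\<integral>\<^sup>+y. \<integral>\<^sup>+x. f (Complex (t * y + 1 * x) y) \<partial>lborel \<partial>lborel)"
    by (subst nn_integral_lborel_Complex(2))
       (simp_all add: Complex_eq algebra_simps)
  also have "\<dots> = (\<integral>\<^sup>+y. \<integral>\<^sup>+x. f (Complex x y) \<partial>lborel \<partial>lborel)"
  proof (rule nn_integral_cong)
    fix y show "(\<integral>\<^sup>+x. f (Complex (t * y + 1 * x) y) \<partial>lborel) = (\<integral>\<^sup>+x. f (Complex x y) \<partial>lborel)"
      using nn_integral_real_affine[of "\<lambda>x. f (Complex x y)" 1 "t * y"] by simp
  qed
  also have "\<dots> = (\<integral>\<^sup>+z. f z \<partial>lborel)" by (simp add: nn_integral_lborel_Complex(2))
  finally show ?thesis .
qed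

lemma nn_integral_shear_Im:
  assumes [measurable]: "f \<in> borel_measurable borel"
  shows "(\<integral>\<^sup>+z. f (z + \<i> * of_real (t * Re z)) \<partial>lborel) = (\<integral>\<^sup>+z. f z \<partial>lborel)"
proof -
  have [measurable]: "(\<lambda>y. f (Complex x y)) \<in> borel_measurable borel" for x
    unfolding Complex_eq by measurable
  have "(\<integral>\<^sup>+z. f (z + \<i> * of_real (t * Re z)) \<partial>lborel)
      = (\<integral>\<^sup>+x. \<integral>\<^sup>+y. f (Complex x (t * x + 1 * y)) \<partial>lborel \<partial>lborel)"
    by (subst nn_integral_lborel_Complex(1))
       (simp_all add: Complex_eq algebra_simps)
  also have "\<dots> = (\<integral>\<^sup>+x. \<integral>\<^sup>+y. f (Complex x y) \<partial>lborel \<partial>lborel)"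
  proof (rule nn_integral_cong)
    fix x show "(\<integral>\<^sup>+y. f (Complex x (t * x + 1 * y)) \<partial>lborel) = (\<integral>\<^sup>+y. f (Complex x y) \<partial>lborel)"
      using nn_integral_real_affine[of "\<lambda>y. f (Complex x y)" 1 "t * x"] by simp
  qed
  also have "\<dots> = (\<integral>\<^sup>+z. f z \<partial>lborel)" by (simp add: nn_integral_lborel_Complex(1))
  finally show ?thesis .
qed

text \<open>A rotation other than by the angle \<open>\<pi>\<close> is a product of three shears.\<close>

lemma nn_integral_lborel_rotate:
  assumes [measurable]: "f \<in> borel_measurable borel" and c: "cmod c = 1" "c \<noteq> -1"
  shows "(\<integral>\<^sup>+z. f (c * z) \<partial>lborel) = (\<integral>\<^sup>+z. f z \<partial>lborel)"
proof -
  define a b where "a = Re c" and "b = Im c"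
  have ab: "a\<^sup>2 + b\<^sup>2 = 1" using c by (simp add: a_def b_def cmod_def)
  have a1: "1 + a \<noteq> 0"
  proof
    assume "1 + a = 0"
    then have "a = -1" by simp
    then have "b = 0" using ab by simp
    then show False using \<open>a = -1\<close> c by (auto simp: a_def b_def complex_eq_iff)
  qed
  \<comment> \<open>Minus the tangent of half the rotation angle; the middle shear uses its sine
    \<open>b\<close>. The angle pi is where the denominator would vanish.\<close>
  define t where "t = - b / (1 + a)"
  have "t * b = - (b\<^sup>2) / (1 + a)" by (simp add: t_def power2_eq_square)
  also have "b\<^sup>2 = (1 - a) * (1 + a)" using ab by (simp add: algebra_simps power2_eq_square)
  finally have tb: "t * b = a - 1" using a1 by simp
  have ta: "t * (1 + a) = - b" using a1 by (simp add: t_def)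
  define p where "p z = z + of_real (t * Im z)" for z
  define q where "q z = z + \<i> * of_real (b * Re z)" for z
  have [measurable]: "p \<in> borel_measurable borel" "q \<in> borel_measurable borel"
    unfolding p_def[abs_def] q_def[abs_def] by measurable
  have rot: "p (q (p z)) = c * z" for z
  proof (rule complex_eqI)
    have "Re (p (q (p z))) = (1 + t * b) * Re z + (t + t * (1 + t * b)) * Im z"
      by (simp add: p_def q_def algebra_simps)
    also have "\<dots> = a * Re z + (t * (1 + a)) * Im z" unfolding tb by (simp add: algebra_simps)
    finally show "Re (p (q (p z))) = Re (c * z)" unfolding ta by (simp add: a_def b_def)
    have "Im (p (q (p z))) = b * Re z + (1 + t * b) * Im z"
      by (simp add: p_def q_def algebra_simps)
    then show "Im (p (q (p z))) = Im (c * z)" unfolding tb by (simp add: a_def b_def)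
  qed
  have "(\<integral>\<^sup>+z. f (c * z) \<partial>lborel) = (\<integral>\<^sup>+z. (\<lambda>z. f (p (q z))) (p z) \<partial>lborel)" by (simp add: rot)
  also have "\<dots> = (\<integral>\<^sup>+z. f (p (q z)) \<partial>lborel)"
    unfolding p_def by (rule nn_integral_shear_Re) (unfold p_def[symmetric], measurable)
  also have "\<dots> = (\<integral>\<^sup>+z. f (p z) \<partial>lborel)"
    using nn_integral_shear_Im[of "\<lambda>z. f (p z)" b] by (simp add: q_def)
  also have "\<dots> = (\<integral>\<^sup>+z. f z \<partial>lborel)"
    unfolding p_def by (rule nn_integral_shear_Re) measurable
  finally show ?thesis .
qed

text \<open>This replaces polar coordinates: the annulus between the radii sqrt x and 1 has area pi
  (1 - x), linear in \<open>x\<close>, so the squared modulus has constant density. It suffices to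
  compare the measures of half-lines.\<close>

lemma distr_cmod_square_ball:
  "distr (density lborel (indicator (ball (0::complex) 1))) borel (\<lambda>z. (cmod z)\<^sup>2)
     = density lborel (\<lambda>r. ennreal pi * indicator {0..<1} r)"
proof (rule measure_eqI_lessThan)
  let ?M = "distr (density lborel (indicator (ball (0::complex) 1))) borel (\<lambda>z. (cmod z)\<^sup>2)"
  let ?N = "density lborel (\<lambda>r. ennreal pi * indicator {0..<1::real} r)"
  have M: "emeasure ?M {x<..} = emeasure lborel (ball (0::complex) 1 \<inter> {z. x < (cmod z)\<^sup>2})" for x
  proof -
    have [measurable]: "{z::complex. x < (cmod z)\<^sup>2} \<in> sets borel" by measurable
    have "emeasure ?M {x<..} = emeasure (density lborel (indicator (ball 0 1))) {z::complex. x < (cmod z)\<^sup>2}"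
      by (subst emeasure_distr) (auto intro!: arg_cong2[where f=emeasure])
    also have "\<dots> = (\<integral>\<^sup>+z. indicator (ball 0 1) z * indicator {z::complex. x < (cmod z)\<^sup>2} z \<partial>lborel)"
      by (subst emeasure_density) (auto intro!: borel_measurable_indicator)
    also have "\<dots> = (\<integral>\<^sup>+z. indicator (ball 0 1 \<inter> {z::complex. x < (cmod z)\<^sup>2}) z \<partial>lborel)"
      by (simp only: indicator_inter_arith)
    finally show ?thesis by simp
  qed
  have N: "emeasure ?N {x<..} = ennreal pi * emeasure lborel ({0..<1::real} \<inter> {x<..})" for x
  proof -
    have "emeasure ?N {x<..} = (\<integral>\<^sup>+r. ennreal pi * indicator ({0..<1::real} \<inter> {x<..}) r \<partial>lborel)"
      by (subst emeasure_density) (auto simp: indicator_inter_arith mult.assoc)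
    also have "\<dots> = ennreal pi * emeasure lborel ({0..<1::real} \<inter> {x<..})"
      by (subst nn_integral_cmult) auto
    finally show ?thesis .
  qed
  have ball: "emeasure lborel (ball (0::complex) 1) = ennreal pi"
    by (simp add: emeasure_ball unit_ball_vol_2)
  fix x :: real
  have "emeasure ?M {x<..} \<le> emeasure lborel (ball (0::complex) 1)"
    unfolding M by (rule emeasure_mono) auto
  then show fin: "emeasure ?M {x<..} < \<infinity>" using ball le_less_trans by fastforce
  consider "x < 0" | "0 \<le> x" "x < 1" | "1 \<le> x" by linarith
  then show "emeasure ?M {x<..} = emeasure ?N {x<..}"
  proof cases
    case 1
    have "ball (0::complex) 1 \<inter> {z. x < (cmod z)\<^sup>2} = ball 0 1"
      using 1 by (auto intro: less_le_trans)
    moreover have "{0..<1::real} \<inter> {x<..} = {0..<1}" using 1 by auto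
    ultimately show ?thesis unfolding M N by (simp add: ball)
  next
    case 2
    have iff: "x < (cmod z)\<^sup>2 \<longleftrightarrow> sqrt x < cmod z" for z :: complex
      using real_sqrt_less_iff[of x "(cmod z)\<^sup>2"] by simp
    have "ball (0::complex) 1 \<inter> {z. x < (cmod z)\<^sup>2} = ball 0 1 - cball 0 (sqrt x)"
      unfolding iff by auto
    moreover have "cball (0::complex) (sqrt x) \<subseteq> ball 0 1"
      using 2 by (simp add: cball_subset_ball_iff)
    moreover have "emeasure lborel (cball (0::complex) (sqrt x)) = ennreal (pi * x)"
      using 2 by (simp add: emeasure_cball unit_ball_vol_2)
    ultimately have "emeasure ?M {x<..} = ennreal pi - ennreal (pi * x)"
      unfolding M by (simp add: emeasure_Diff ball)
    also have "\<dots> = ennreal (pi * (1 - x))" using 2 by (simp add: ennreal_minus algebra_simps)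
    also have "{0..<1::real} \<inter> {x<..} = {x<..<1}" using 2 by auto
    then have "ennreal (pi * (1 - x)) = emeasure ?N {x<..}" unfolding N using 2 by (simp add: ennreal_mult)
    finally show ?thesis .
  next
    case 3
    have "ball (0::complex) 1 \<inter> {z. x < (cmod z)\<^sup>2} = {}"
    proof (rule ccontr)
      assume "\<not> ?thesis"
      then obtain z :: complex where z: "cmod z < 1" "x < (cmod z)\<^sup>2" by auto
      then have "(cmod z)\<^sup>2 \<le> 1" by (simp add: power_le_one)
      then show False using z 3 by linarith
    qed
    moreover have "{0..<1::real} \<inter> {x<..} = {}" using 3 by auto
    ultimately show ?thesis unfolding M N by simp
  qed
qed auto

section \<open>Parseval identity on smaller disks\<close>


definition disk_density :: "real \<Rightarrow> complex \<Rightarrow> real" where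
  "disk_density \<alpha> z = (\<alpha> + 1) / pi * (1 - (cmod z)\<^sup>2) powr \<alpha> * indicator (ball 0 1) z"

text \<open>The same measure as \<open>weighted_area\<close>, but carried by the whole plane with a
  density vanishing off the disk, so that rotations and Borel functions need no restriction of the
  space.\<close>

definition disk_measure :: "real \<Rightarrow> complex measure" where
  "disk_measure \<alpha> = density lborel (\<lambda>z. ennreal (disk_density \<alpha> z))"

lemma measurable_pred_ball [measurable]:
  "Measurable.pred borel (\<lambda>x. x \<in> ball (c :: 'a :: real_normed_vector) r)"
proof -
  have "{x \<in> space borel. x \<in> ball c r} = ball c r" by auto
  then show ?thesis by (simp only: pred_def) (rule borel_open, rule open_ball)
qed

lemma borel_measurable_cnj [measurable]: "cnj \<in> borel_measurable borel"
  by (intro borel_measurable_continuous_onI continuous_intros)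

lemma borel_measurable_disk_density [measurable]: "disk_density \<alpha> \<in> borel_measurable borel"
  unfolding disk_density_def[abs_def] by measurable

lemma sets_disk_measure [simp, measurable_cong]: "sets (disk_measure \<alpha>) = sets borel"
  and space_disk_measure [simp]: "space (disk_measure \<alpha>) = UNIV"
  by (simp_all add: disk_measure_def)

lemma space_weighted_area: "space (weighted_area \<alpha>) = ball 0 1"
  by (simp add: weighted_area_def disk_area_def space_scale_measure space_restrict_space)

lemma sets_weighted_area: "sets (weighted_area \<alpha>) = sets (restrict_space borel (ball 0 1))"
  by (simp add: weighted_area_def disk_area_def cong: sets_restrict_space_cong)

lemma nn_integral_weighted_area:
  assumes "-1 < \<alpha>" and [measurable]: "g \<in> borel_measurable borel"
  shows "(\<integral>\<^sup>+z. g z \<partial>weighted_area \<alpha>) = (\<integral>\<^sup>+z. g z \<partial>disk_measure \<alpha>)"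
proof -
  let ?h = "\<lambda>z. ennreal ((\<alpha> + 1) * (1 - (cmod z)\<^sup>2) powr \<alpha>)"
  have meas: "k \<in> borel_measurable disk_area" if [measurable]: "k \<in> borel_measurable borel"
    for k :: "complex \<Rightarrow> ennreal"
    unfolding disk_area_def by (simp add: measurable_cong_sets[OF sets_scale_measure refl] measurable_restrict_space1 that)
  have "(\<integral>\<^sup>+z. g z \<partial>weighted_area \<alpha>) = (\<integral>\<^sup>+z. ?h z * g z \<partial>disk_area)"
    unfolding weighted_area_def by (rule nn_integral_density) (auto intro!: meas)
  also have "\<dots> = ennreal (1 / pi) * (\<integral>\<^sup>+z. ?h z * g z \<partial>restrict_space lborel (ball 0 1))"
    unfolding disk_area_def
    by (rule nn_integral_scale_measure) (auto intro!: measurable_restrict_space1)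
  also have "\<dots> = ennreal (1 / pi) * (\<integral>\<^sup>+z. ?h z * g z * indicator (ball 0 1) z \<partial>lborel)"
    by (subst nn_integral_restrict_space) auto
  also have "\<dots> = (\<integral>\<^sup>+z. ennreal (1 / pi) * (?h z * g z * indicator (ball 0 1) z) \<partial>lborel)"
    by (rule nn_integral_cmult[symmetric]) measurable
  also have "\<dots> = (\<integral>\<^sup>+z. ennreal (disk_density \<alpha> z) * g z \<partial>lborel)"
  proof (rule nn_integral_cong)
    fix z :: complex
    have "ennreal (disk_density \<alpha> z)
        = ennreal (1 / pi) * ?h z * indicator (ball 0 1) z"
      using assms by (auto simp: disk_density_def ennreal_mult[symmetric] split: split_indicator)
    then show "ennreal (1 / pi) * (?h z * g z * indicator (ball 0 1) z) = ennreal (disk_density \<alpha> z) * g z"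
      by (simp add: mult_ac)
  qed
  also have "\<dots> = (\<integral>\<^sup>+z. g z \<partial>disk_measure \<alpha>)"
    unfolding disk_measure_def by (subst nn_integral_density) auto
  finally show ?thesis .
qed

text \<open>In the variable r, the squared modulus, the moment is \<alpha> + 1 times the Beta
  integral with parameters n + 1 and \<alpha> + 1; the factor \<alpha> + 1 is absorbed by the
  functional equation of \<open>Gamma\<close>.\<close>

lemma nn_integral_disk_measure_power:
  assumes "-1 < \<alpha>"
  shows "(\<integral>\<^sup>+z. ennreal (cmod z ^ (2 * n)) \<partial>disk_measure \<alpha>) = ennreal (bergman_weight ((\<alpha> + 2) / 2) n)"
proof -
  define h where "h r = ennreal ((\<alpha> + 1) / pi * (1 - r) powr \<alpha> * r ^ n)" for r
  have [measurable]: "h \<in> borel_measurable borel" unfolding h_def[abs_def] by measurable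
  have two: "(2::real) \<noteq> 0" by simp
  have indm: "(indicator (ball 0 1) :: complex \<Rightarrow> ennreal) \<in> borel_measurable borel"
    by (intro borel_measurable_indicator) auto
  have "(\<integral>\<^sup>+z. ennreal (cmod z ^ (2 * n)) \<partial>disk_measure \<alpha>)
      = (\<integral>\<^sup>+z. ennreal (disk_density \<alpha> z) * ennreal (cmod z ^ (2 * n)) \<partial>lborel)"
    unfolding disk_measure_def by (subst nn_integral_density) auto
  also have "\<dots> = (\<integral>\<^sup>+z. indicator (ball 0 1) z * h ((cmod z)\<^sup>2) \<partial>lborel)"
  proof (rule nn_integral_cong)
    fix z :: complex
    show "ennreal (disk_density \<alpha> z) * ennreal (cmod z ^ (2 * n)) = indicator (ball 0 1) z * h ((cmod z)\<^sup>2)"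
      using assms by (auto simp: disk_density_def h_def power_mult ennreal_mult[symmetric] split: split_indicator)
  qed
  also have "\<dots> = (\<integral>\<^sup>+z. h ((cmod z)\<^sup>2) \<partial>density lborel (indicator (ball 0 1)))"
    by (subst nn_integral_density) (auto intro!: indm)
  also have "\<dots> = (\<integral>\<^sup>+r. h r \<partial>distr (density lborel (indicator (ball (0::complex) 1))) borel (\<lambda>z. (cmod z)\<^sup>2))"
    by (subst nn_integral_distr) auto
  also have "\<dots> = (\<integral>\<^sup>+r. ennreal pi * indicator {0..<1} r * h r \<partial>lborel)"
    unfolding distr_cmod_square_ball by (subst nn_integral_density) auto
  also have "\<dots> = (\<integral>\<^sup>+r. ennreal ((\<alpha> + 1) * (r ^ n * (1 - r) powr \<alpha>)) * indicator {0..1} r \<partial>lborel)"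
  proof (rule nn_integral_cong)
    fix r :: real
    show "ennreal pi * indicator {0..<1} r * h r = ennreal ((\<alpha> + 1) * (r ^ n * (1 - r) powr \<alpha>)) * indicator {0..1} r"
    \<comment> \<open>The intervals differ at this point, but \<open>0 powr \<alpha> = 0\<close>
      makes both sides vanish.\<close>
    proof (cases "r = 1")
      case False
      then show ?thesis
        using assms by (auto simp: h_def ennreal_mult[symmetric] mult_ac split: split_indicator)
    qed simp
  qed
  also have "\<dots> = ennreal ((\<alpha> + 1) * Beta (real n + 1) (\<alpha> + 1))"
  proof (rule nn_integral_has_integral_lebesgue')
    have "((\<lambda>t. t powr (real n + 1 - 1) * (1 - t) powr (\<alpha> + 1 - 1)) has_integral Beta (real n + 1) (\<alpha> + 1)) {0..1}"
      using assms by (intro has_integral_Beta_real) auto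
    then have "((\<lambda>t. t ^ n * (1 - t) powr \<alpha>) has_integral Beta (real n + 1) (\<alpha> + 1)) {0..1}"
      \<comment> \<open>The exception at 0 is due to \<open>n = 0\<close>, where
        \<open>0 powr 0 = 0\<close> but \<open>0 ^ 0 = 1\<close>.\<close>
      by (rule has_integral_spike_finite[of "{0}", rotated 2]) (auto simp: powr_realpow)
    then show "((\<lambda>t. (\<alpha> + 1) * (t ^ n * (1 - t) powr \<alpha>)) has_integral (\<alpha> + 1) * Beta (real n + 1) (\<alpha> + 1)) {0..1}"
      by (rule has_integral_mult_right)
  qed (use assms in auto)
  also have "(\<alpha> + 1) * Beta (real n + 1) (\<alpha> + 1) = bergman_weight ((\<alpha> + 2) / 2) n"
    unfolding bergman_weight_def nonzero_mult_div_cancel_left[OF two] times_divide_eq_right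
    using Gamma_plus1_real[of "\<alpha> + 1"] assms Gamma_fact[of n, where ?'a=real]
    by (simp add: Beta_def add_ac)
  finally show ?thesis .
qed

lemma nn_integral_disk_measure_rotate:
  assumes [measurable]: "g \<in> borel_measurable borel" and c: "cmod c = 1" "c \<noteq> -1"
  shows "(\<integral>\<^sup>+z. g (c * z) \<partial>disk_measure \<alpha>) = (\<integral>\<^sup>+z. g z \<partial>disk_measure \<alpha>)"
proof -
  have rho: "disk_density \<alpha> (c * z) = disk_density \<alpha> z" for z
    using c by (simp add: disk_density_def norm_mult indicator_def)
  have "(\<integral>\<^sup>+z. g (c * z) \<partial>disk_measure \<alpha>) = (\<integral>\<^sup>+z. ennreal (disk_density \<alpha> (c * z)) * g (c * z) \<partial>lborel)"
    unfolding disk_measure_def rho by (subst nn_integral_density) auto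
  also have "\<dots> = (\<integral>\<^sup>+z. ennreal (disk_density \<alpha> z) * g z \<partial>lborel)"
    by (rule nn_integral_lborel_rotate) (use c in auto)
  also have "\<dots> = (\<integral>\<^sup>+z. g z \<partial>disk_measure \<alpha>)"
    unfolding disk_measure_def by (subst nn_integral_density) auto
  finally show ?thesis .
qed

lemma distr_disk_measure_rotate:
  assumes c: "cmod c = 1" "c \<noteq> -1"
  shows "distr (disk_measure \<alpha>) borel ((*) c) = disk_measure \<alpha>"
proof (rule measure_eqI)
  fix A assume "A \<in> sets (distr (disk_measure \<alpha>) borel ((*) c))"
  then have A[measurable]: "A \<in> sets borel" by simp
  have "emeasure (distr (disk_measure \<alpha>) borel ((*) c)) A = (\<integral>\<^sup>+z. indicator A z \<partial>distr (disk_measure \<alpha>) borel ((*) c))"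
    by simp
  also have "\<dots> = (\<integral>\<^sup>+z. indicator A (c * z) \<partial>disk_measure \<alpha>)"
    by (rule nn_integral_distr) auto
  also have "\<dots> = (\<integral>\<^sup>+z. indicator A z \<partial>disk_measure \<alpha>)"
    by (rule nn_integral_disk_measure_rotate) (use c in auto)
  finally show "emeasure (distr (disk_measure \<alpha>) borel ((*) c)) A = emeasure (disk_measure \<alpha>) A" by simp
qed simp

lemma finite_measure_disk_measure:
  assumes "-1 < \<alpha>"
  shows "finite_measure (disk_measure \<alpha>)"
proof
  have "emeasure (disk_measure \<alpha>) (space (disk_measure \<alpha>)) = (\<integral>\<^sup>+z. ennreal (cmod z ^ (2 * 0)) \<partial>disk_measure \<alpha>)"
    by simp
  also have "\<dots> \<noteq> \<infinity>" unfolding nn_integral_disk_measure_power[OF assms] by simp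
  finally show "emeasure (disk_measure \<alpha>) (space (disk_measure \<alpha>)) \<noteq> \<infinity>" .
qed

lemma integrable_disk_measure_ball:
  fixes g :: "complex \<Rightarrow> 'a :: {banach, second_countable_topology}"
  assumes "-1 < \<alpha>" "g \<in> borel_measurable borel" "\<And>z. cmod z < R \<Longrightarrow> norm (g z) \<le> B"
  shows "integrable (disk_measure \<alpha>) (\<lambda>z. indicator (ball 0 R) z *\<^sub>R g z)"
proof -
  interpret finite_measure "disk_measure \<alpha>" by (rule finite_measure_disk_measure) fact
  show ?thesis
  proof (rule integrable_const_bound[of _ "max B 0"])
    show "AE z in disk_measure \<alpha>. norm (indicator (ball 0 R) z *\<^sub>R g z) \<le> max B 0"
      using assms(3) by (auto intro!: always_eventually split: split_indicator simp: le_max_iff_disj)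
    show "(\<lambda>z. indicator (ball 0 R) z *\<^sub>R g z) \<in> borel_measurable (disk_measure \<alpha>)"
      using assms(2) by measurable
  qed
qed

section \<open>Orthogonality of monomials and the passage to power series\<close>

lemma integrable_disk_measure_monomial:
  assumes "-1 < \<alpha>"
  shows "integrable (disk_measure \<alpha>) (\<lambda>z. indicator (ball 0 R) z *\<^sub>R (z ^ n * cnj z ^ m))"
proof (rule integrable_disk_measure_ball[OF assms])
  show "norm (z ^ n * cnj z ^ m) \<le> \<bar>R\<bar> ^ n * \<bar>R\<bar> ^ m" if "cmod z < R" for z
    using that by (auto simp: norm_mult norm_power intro!: mult_mono power_mono)
qed measurable

text \<open>A rotation by \<open>c\<close> multiplies the integrand by
  \<open>c ^ n * cnj c ^ m\<close>. With \<open>c\<close> chosen so that this factor is the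
  imaginary unit, invariance forces the integral to be 0.\<close>

lemma integral_disk_measure_orthogonal:
  assumes "n \<noteq> m"
  shows "(LINT z|disk_measure \<alpha>. indicator (ball 0 R) z *\<^sub>R (z ^ n * cnj z ^ m)) = 0"
proof -
  define d where "d = real n - real m"
  \<comment> \<open>Aiming at the factor -1 instead would, when the exponents differ by 1, require
    the excluded rotation \<open>c = -1\<close>; the present angle never exceeds pi / 2 in absolute
    value.\<close>
  define c where "c = cis (pi / (2 * d))"
  define F where "F z = indicator (ball 0 R) z *\<^sub>R (z ^ n * cnj z ^ m)" for z
  have [measurable]: "F \<in> borel_measurable borel" unfolding F_def[abs_def] by measurable
  have d1: "\<bar>d\<bar> \<ge> 1" using assms by (auto simp: d_def)
  have "\<bar>pi / (2 * d)\<bar> \<le> pi / 2" using d1 by (simp add: abs_mult divide_simps)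
  then have "cos (pi / (2 * d)) \<ge> 0" unfolding abs_le_iff by (intro cos_ge_zero) linarith+
  then have c1: "c \<noteq> -1" by (auto simp: c_def complex_eq_iff)
  have c: "cmod c = 1" by (simp add: c_def)
  have cancel: "(d + y) * x + - (y * x) = d * x" for x y :: real
    by (simp add: distrib_right)
  have "c ^ n * cnj c ^ m = cis (real n * (pi / (2 * d)) + - (real m * (pi / (2 * d))))"
    by (simp add: c_def Complex.DeMoivre cis_cnj cis_mult)
  also have "real n = d + real m" by (simp add: d_def)
  also have "(d + real m) * (pi / (2 * d)) + - (real m * (pi / (2 * d))) = d * (pi / (2 * d))"
    by (rule cancel)
  also have "\<dots> = pi / 2" using d1 by auto
  finally have ci: "c ^ n * cnj c ^ m = \<i>" by simp
  have Fc: "F (c * z) = \<i> * F z" for z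
  proof -
    have "(c * z) ^ n * cnj (c * z) ^ m = (c ^ n * cnj c ^ m) * (z ^ n * cnj z ^ m)"
      by (simp add: power_mult_distrib)
    then show ?thesis using c by (simp add: F_def ci norm_mult indicator_def)
  qed
  have "(LINT z|disk_measure \<alpha>. F z) = (LINT z|distr (disk_measure \<alpha>) borel ((*) c). F z)"
    by (simp add: distr_disk_measure_rotate c c1)
  also have "\<dots> = (LINT z|disk_measure \<alpha>. F (c * z))"
    by (rule integral_distr) auto
  also have "\<dots> = \<i> * (LINT z|disk_measure \<alpha>. F z)" by (simp add: Fc)
  finally have "(1 - \<i>) * (LINT z|disk_measure \<alpha>. F z) = 0" by (simp add: algebra_simps)
  moreover have "1 - \<i> \<noteq> 0" by (simp add: complex_eq_iff)
  ultimately show ?thesis by (simp add: F_def)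
qed

text \<open>Orthogonality removes the mixed terms of the expanded square. The diagonal stays under
  the integral, so that the moments of smaller disks need not be computed.\<close>

lemma integral_disk_measure_polynomial:
  assumes \<alpha>: "-1 < \<alpha>"
  shows "(LINT z|disk_measure \<alpha>. indicator (ball 0 R) z *\<^sub>R (cmod (\<Sum>n<K. a n * z ^ n))\<^sup>2)
       = (LINT z|disk_measure \<alpha>. indicator (ball 0 R) z *\<^sub>R (\<Sum>n<K. (cmod (a n))\<^sup>2 * cmod z ^ (2 * n)))"
proof -
  define G where "G n m z = indicator (ball 0 R) z *\<^sub>R (z ^ n * cnj z ^ m)" for n m z
  define I where "I n m = (LINT z|disk_measure \<alpha>. G n m z)" for n m
  have int: "integrable (disk_measure \<alpha>) (G n m)" for n m
    unfolding G_def[abs_def] by (rule integrable_disk_measure_monomial[OF \<alpha>])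
  have orth: "n \<noteq> m \<Longrightarrow> I n m = 0" for n m
    unfolding I_def G_def by (rule integral_disk_measure_orthogonal)
  have exp1: "of_real (indicator (ball 0 R) z *\<^sub>R (cmod (\<Sum>n<K. a n * z ^ n))\<^sup>2)
      = (\<Sum>n<K. \<Sum>m<K. (a n * cnj (a m)) * G n m z)" for z
  proof -
    have "of_real ((cmod (\<Sum>n<K. a n * z ^ n))\<^sup>2) = (\<Sum>n<K. a n * z ^ n) * cnj (\<Sum>n<K. a n * z ^ n)"
      by (rule complex_norm_square)
    also have "\<dots> = (\<Sum>n<K. \<Sum>m<K. (a n * cnj (a m)) * (z ^ n * cnj z ^ m))"
      by (simp add: sum_product mult_ac)
    finally have *: "of_real ((cmod (\<Sum>n<K. a n * z ^ n))\<^sup>2)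
        = (\<Sum>n<K. \<Sum>m<K. (a n * cnj (a m)) * (z ^ n * cnj z ^ m))" .
    show ?thesis
    proof (cases "cmod z < R")
      case True
      then have "indicator (ball 0 R) z = (1::real)" by simp
      then show ?thesis by (simp only: scaleR_one * G_def)
    qed (simp add: G_def)
  qed
  have exp2: "of_real (indicator (ball 0 R) z *\<^sub>R (\<Sum>n<K. (cmod (a n))\<^sup>2 * cmod z ^ (2 * n)))
      = (\<Sum>n<K. (a n * cnj (a n)) * G n n z)" for z
  proof -
    have "of_real (cmod z ^ (2 * n)) = (of_real ((cmod z)\<^sup>2) :: complex) ^ n" for n
      by (simp add: power_mult)
    also have "\<dots> n = z ^ n * cnj z ^ n" for n
      by (simp only: complex_norm_square power_mult_distrib)
    finally have "of_real (cmod z ^ (2 * n)) = z ^ n * cnj z ^ n" for n .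
    then have *: "of_real (\<Sum>n<K. (cmod (a n))\<^sup>2 * cmod z ^ (2 * n))
        = (\<Sum>n<K. (a n * cnj (a n)) * (z ^ n * cnj z ^ n))"
      by (simp only: of_real_sum of_real_mult complex_norm_square)
    show ?thesis
    proof (cases "cmod z < R")
      case True
      then have "indicator (ball 0 R) z = (1::real)" by simp
      then show ?thesis by (simp only: scaleR_one * G_def)
    qed (simp add: G_def)
  qed
  have "of_real (LINT z|disk_measure \<alpha>. indicator (ball 0 R) z *\<^sub>R (cmod (\<Sum>n<K. a n * z ^ n))\<^sup>2)
      = (LINT z|disk_measure \<alpha>. (\<Sum>n<K. \<Sum>m<K. (a n * cnj (a m)) * G n m z))"
    by (simp only: integral_complex_of_real[symmetric] exp1)
  also have "\<dots> = (\<Sum>n<K. \<Sum>m<K. (a n * cnj (a m)) * I n m)"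
    using int by (simp add: Bochner_Integration.integral_sum I_def)
  also have "\<dots> = (\<Sum>n<K. \<Sum>m<K. if m = n then (a n * cnj (a n)) * I n n else 0)"
    by (intro sum.cong refl) (simp add: orth)
  also have "\<dots> = (\<Sum>n<K. (a n * cnj (a n)) * I n n)" by simp
  also have "\<dots> = (LINT z|disk_measure \<alpha>. (\<Sum>n<K. (a n * cnj (a n)) * G n n z))"
    using int by (simp add: Bochner_Integration.integral_sum I_def)
  also have "\<dots> = of_real (LINT z|disk_measure \<alpha>. indicator (ball 0 R) z *\<^sub>R (\<Sum>n<K. (cmod (a n))\<^sup>2 * cmod z ^ (2 * n)))"
    by (simp only: integral_complex_of_real[symmetric] exp2)
  finally show ?thesis by (simp only: of_real_eq_iff)
qed

text \<open>Dominated convergence from the polynomial case. Absolute summability at radius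
  \<open>R\<close> bounds both integrands by the constant \<open>S\<^sup>2\<close>; a bound of this
  kind may fail on the full disk.\<close>

lemma nn_integral_disk_measure_power_series_ball:
  assumes \<alpha>: "-1 < \<alpha>" and R: "0 < R" and sm: "summable (\<lambda>n. cmod (a n) * R ^ n)"
  shows "(\<integral>\<^sup>+z. ennreal ((cmod (\<Sum>n. a n * z ^ n))\<^sup>2) * indicator (ball 0 R) z \<partial>disk_measure \<alpha>)
       = (\<integral>\<^sup>+z. (\<Sum>n. ennreal ((cmod (a n))\<^sup>2 * cmod z ^ (2 * n))) * indicator (ball 0 R) z \<partial>disk_measure \<alpha>)"
proof -
  interpret finite_measure "disk_measure \<alpha>" by (rule finite_measure_disk_measure) fact
  define S where "S = (\<Sum>n. cmod (a n) * R ^ n)"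
  have S: "(\<Sum>n<K. cmod (a n) * R ^ n) \<le> S" for K
    unfolding S_def by (rule sum_le_suminf[OF sm]) (use R in auto)
  then have S0: "0 \<le> S" using S[of 0] by simp
  have term_le: "cmod (a n) * cmod z ^ n \<le> cmod (a n) * R ^ n" if "cmod z < R" for n z
    using that by (intro mult_left_mono power_mono) auto
  have sum_le: "(\<Sum>n<K. cmod (a n) * cmod z ^ n) \<le> S" if "cmod z < R" for K z
    using S[of K] sum_mono[of "{..<K}" "\<lambda>n. cmod (a n) * cmod z ^ n" "\<lambda>n. cmod (a n) * R ^ n"] term_le[OF that]
    by (meson order_trans)
  have sm_abs: "summable (\<lambda>n. cmod (a n) * cmod z ^ n)" if "cmod z < R" for z
    by (rule summable_comparison_test'[OF sm, of 0]) (use term_le[OF that] in \<open>auto simp: norm_mult norm_power\<close>)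
  \<comment> \<open>A sum of squares of nonnegative terms is at most the square of their
    sum.\<close>
  have sq_le: "(\<Sum>n<K. (cmod (a n))\<^sup>2 * cmod z ^ (2 * n)) \<le> S\<^sup>2" if "cmod z < R" for K z
  proof -
    have "(\<Sum>n<K. (cmod (a n))\<^sup>2 * cmod z ^ (2 * n)) = (\<Sum>n<K. (cmod (a n) * cmod z ^ n)\<^sup>2)"
      by (simp add: power_mult_distrib power_even_eq)
    also have "\<dots> \<le> (\<Sum>n<K. (cmod (a n) * cmod z ^ n) * S)"
    proof (intro sum_mono)
      fix n assume "n \<in> {..<K}"
      then have "cmod (a n) * cmod z ^ n \<le> (\<Sum>n<K. cmod (a n) * cmod z ^ n)"
        by (intro member_le_sum) auto
      also have "\<dots> \<le> S" by (rule sum_le[OF that])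
      finally show "(cmod (a n) * cmod z ^ n)\<^sup>2 \<le> (cmod (a n) * cmod z ^ n) * S"
        by (simp add: power2_eq_square mult_left_mono)
    qed
    also have "\<dots> \<le> S * S"
      using sum_le[OF that, of K] S0 by (simp add: mult_right_mono flip: sum_distrib_right)
    finally show ?thesis by (simp add: power2_eq_square)
  qed
  have sm_sq: "summable (\<lambda>n. (cmod (a n))\<^sup>2 * cmod z ^ (2 * n))" if "cmod z < R" for z
    by (rule summableI_nonneg_bounded[of _ "S\<^sup>2"]) (use sq_le[OF that] in auto)
    have ptw1: "AE z in disk_measure \<alpha>. (\<lambda>K. indicator (ball 0 R) z *\<^sub>R (cmod (\<Sum>n<K. a n * z ^ n))\<^sup>2)
        \<longlonglongrightarrow> indicator (ball 0 R) z *\<^sub>R (cmod (\<Sum>n. a n * z ^ n))\<^sup>2"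
    proof (intro always_eventually allI)
      fix z
      show "(\<lambda>K. indicator (ball 0 R) z *\<^sub>R (cmod (\<Sum>n<K. a n * z ^ n))\<^sup>2)
        \<longlonglongrightarrow> indicator (ball 0 R) z *\<^sub>R (cmod (\<Sum>n. a n * z ^ n))\<^sup>2"
      proof (cases "cmod z < R")
        case True
        then have "summable (\<lambda>n. a n * z ^ n)"
          by (intro summable_norm_cancel[of "\<lambda>n. a n * z ^ n"]) (simp add: norm_mult norm_power sm_abs)
        then show ?thesis by (intro tendsto_intros summable_LIMSEQ)
      qed simp
    qed
    have bnd1: "AE z in disk_measure \<alpha>. norm (indicator (ball 0 R) z *\<^sub>R (cmod (\<Sum>n<K. a n * z ^ n))\<^sup>2) \<le> S\<^sup>2" for K
    proof (intro always_eventually allI)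
      fix z
      show "norm (indicator (ball 0 R) z *\<^sub>R (cmod (\<Sum>n<K. a n * z ^ n))\<^sup>2) \<le> S\<^sup>2"
      proof (cases "cmod z < R")
        case True
        have "cmod (\<Sum>n<K. a n * z ^ n) \<le> (\<Sum>n<K. cmod (a n) * cmod z ^ n)"
          by (rule order_trans[OF norm_sum]) (simp add: norm_mult norm_power)
        also have "\<dots> \<le> S" by (rule sum_le[OF True])
        finally have "(cmod (\<Sum>n<K. a n * z ^ n))\<^sup>2 \<le> S\<^sup>2" by (intro power_mono) auto
        then show ?thesis using True by simp
      qed simp
    qed
  note dom1 = integral_dominated_convergence[where w = "\<lambda>_. S\<^sup>2", OF _ _ _ ptw1 bnd1]
    integrable_dominated_convergence[where w = "\<lambda>_. S\<^sup>2", OF _ _ _ ptw1 bnd1]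
  have lim1: "(\<lambda>K. LINT z|disk_measure \<alpha>. indicator (ball 0 R) z *\<^sub>R (cmod (\<Sum>n<K. a n * z ^ n))\<^sup>2)
     \<longlonglongrightarrow> (LINT z|disk_measure \<alpha>. indicator (ball 0 R) z *\<^sub>R (cmod (\<Sum>n. a n * z ^ n))\<^sup>2)"
    by (rule dom1(1)) auto
  have int1: "integrable (disk_measure \<alpha>) (\<lambda>z. indicator (ball 0 R) z *\<^sub>R (cmod (\<Sum>n. a n * z ^ n))\<^sup>2)"
    by (rule dom1(2)) auto
    have ptw2: "AE z in disk_measure \<alpha>. (\<lambda>K. indicator (ball 0 R) z *\<^sub>R (\<Sum>n<K. (cmod (a n))\<^sup>2 * cmod z ^ (2 * n)))
        \<longlonglongrightarrow> indicator (ball 0 R) z *\<^sub>R (\<Sum>n. (cmod (a n))\<^sup>2 * cmod z ^ (2 * n))"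
    proof (intro always_eventually allI)
      fix z
      show "(\<lambda>K. indicator (ball 0 R) z *\<^sub>R (\<Sum>n<K. (cmod (a n))\<^sup>2 * cmod z ^ (2 * n)))
        \<longlonglongrightarrow> indicator (ball 0 R) z *\<^sub>R (\<Sum>n. (cmod (a n))\<^sup>2 * cmod z ^ (2 * n))"
      proof (cases "cmod z < R")
        case True
        then show ?thesis by (intro tendsto_intros summable_LIMSEQ sm_sq)
      qed simp
    qed
    have bnd2: "AE z in disk_measure \<alpha>. norm (indicator (ball 0 R) z *\<^sub>R (\<Sum>n<K. (cmod (a n))\<^sup>2 * cmod z ^ (2 * n))) \<le> S\<^sup>2" for K
    proof (intro always_eventually allI)
      fix z
      show "norm (indicator (ball 0 R) z *\<^sub>R (\<Sum>n<K. (cmod (a n))\<^sup>2 * cmod z ^ (2 * n))) \<le> S\<^sup>2"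
        using sq_le[of z K] by (auto split: split_indicator simp: sum_nonneg)
    qed
  note dom2 = integral_dominated_convergence[where w = "\<lambda>_. S\<^sup>2", OF _ _ _ ptw2 bnd2]
    integrable_dominated_convergence[where w = "\<lambda>_. S\<^sup>2", OF _ _ _ ptw2 bnd2]
  have lim2: "(\<lambda>K. LINT z|disk_measure \<alpha>. indicator (ball 0 R) z *\<^sub>R (\<Sum>n<K. (cmod (a n))\<^sup>2 * cmod z ^ (2 * n)))
     \<longlonglongrightarrow> (LINT z|disk_measure \<alpha>. indicator (ball 0 R) z *\<^sub>R (\<Sum>n. (cmod (a n))\<^sup>2 * cmod z ^ (2 * n)))"
    by (rule dom2(1)) auto
  have int2: "integrable (disk_measure \<alpha>) (\<lambda>z. indicator (ball 0 R) z *\<^sub>R (\<Sum>n. (cmod (a n))\<^sup>2 * cmod z ^ (2 * n)))"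
    by (rule dom2(2)) auto
  have eq: "(LINT z|disk_measure \<alpha>. indicator (ball 0 R) z *\<^sub>R (cmod (\<Sum>n. a n * z ^ n))\<^sup>2)
       = (LINT z|disk_measure \<alpha>. indicator (ball 0 R) z *\<^sub>R (\<Sum>n. (cmod (a n))\<^sup>2 * cmod z ^ (2 * n)))"
    using LIMSEQ_unique[OF lim1[unfolded integral_disk_measure_polynomial[OF \<alpha>]] lim2] .
  have "(\<integral>\<^sup>+z. ennreal ((cmod (\<Sum>n. a n * z ^ n))\<^sup>2) * indicator (ball 0 R) z \<partial>disk_measure \<alpha>)
      = (\<integral>\<^sup>+z. ennreal (indicator (ball 0 R) z *\<^sub>R (cmod (\<Sum>n. a n * z ^ n))\<^sup>2) \<partial>disk_measure \<alpha>)"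
    by (intro nn_integral_cong) (auto split: split_indicator)
  also have "\<dots> = (\<integral>\<^sup>+z. ennreal (indicator (ball 0 R) z *\<^sub>R (\<Sum>n. (cmod (a n))\<^sup>2 * cmod z ^ (2 * n))) \<partial>disk_measure \<alpha>)"
  proof -
    have nn: "0 \<le> indicator (ball 0 R) z *\<^sub>R (\<Sum>n. (cmod (a n))\<^sup>2 * cmod z ^ (2 * n))" for z
    proof (cases "cmod z < R")
      case True
      then show ?thesis using suminf_nonneg[OF sm_sq[OF True]] by simp
    qed simp
    have "(\<integral>\<^sup>+z. ennreal (indicator (ball 0 R) z *\<^sub>R (cmod (\<Sum>n. a n * z ^ n))\<^sup>2) \<partial>disk_measure \<alpha>)
        = ennreal (LINT z|disk_measure \<alpha>. indicator (ball 0 R) z *\<^sub>R (cmod (\<Sum>n. a n * z ^ n))\<^sup>2)"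
      by (rule nn_integral_eq_integral[OF int1]) simp
    also have "\<dots> = ennreal (LINT z|disk_measure \<alpha>. indicator (ball 0 R) z *\<^sub>R (\<Sum>n. (cmod (a n))\<^sup>2 * cmod z ^ (2 * n)))"
      by (simp only: eq)
    also have "\<dots> = (\<integral>\<^sup>+z. ennreal (indicator (ball 0 R) z *\<^sub>R (\<Sum>n. (cmod (a n))\<^sup>2 * cmod z ^ (2 * n))) \<partial>disk_measure \<alpha>)"
      by (rule nn_integral_eq_integral[OF int2, symmetric]) (use nn in simp)
    finally show ?thesis .
  qed
  also have "\<dots> = (\<integral>\<^sup>+z. (\<Sum>n. ennreal ((cmod (a n))\<^sup>2 * cmod z ^ (2 * n))) * indicator (ball 0 R) z \<partial>disk_measure \<alpha>)"
  proof (rule nn_integral_cong)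
    fix z
    show "ennreal (indicator (ball 0 R) z *\<^sub>R (\<Sum>n. (cmod (a n))\<^sup>2 * cmod z ^ (2 * n)))
        = (\<Sum>n. ennreal ((cmod (a n))\<^sup>2 * cmod z ^ (2 * n))) * indicator (ball 0 R) z"
    proof (cases "cmod z < R")
      case True
      then have "indicator (ball 0 R) z = (1::real)" "indicator (ball 0 R) z = (1::ennreal)" by simp_all
      moreover have "(\<Sum>n. ennreal ((cmod (a n))\<^sup>2 * cmod z ^ (2 * n))) = ennreal (\<Sum>n. (cmod (a n))\<^sup>2 * cmod z ^ (2 * n))"
        by (rule suminf_ennreal2[OF _ sm_sq[OF True]]) simp
      ultimately show ?thesis by (simp only: scaleR_one mult_1_right)
    next
      case False
      then have "indicator (ball 0 R) z = (0::real)" "indicator (ball 0 R) z = (0::ennreal)" by simp_all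
      then show ?thesis by (simp only: scaleR_zero_left mult_zero_right ennreal_0)
    qed
  qed
  finally show ?thesis .
qed

section \<open>Bergman spaces as weighted sequence spaces\<close>


lemma taylor_coeff_sums:
  assumes "f holomorphic_on ball 0 1" "cmod z < 1"
  shows "(\<lambda>n. taylor_coeff f n * z ^ n) sums f z"
  using holomorphic_power_series[OF assms(1), of z] assms(2) by (simp add: taylor_coeff_def)

lemma taylor_coeff_eqI:
  assumes "\<And>z. cmod z < 1 \<Longrightarrow> (\<lambda>n. a n * z ^ n) sums f z"
  shows "taylor_coeff f n = a n"
proof -
  have "f has_fps_expansion Abs_fps a"
    unfolding has_fps_expansion_def
  proof
    \<comment> \<open>Convergence at one nonzero point is enough for a positive radius.\<close>
    have "conv_radius a \<ge> norm (1 / 2 :: complex)"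
      using assms[of "1 / 2"] by (intro conv_radius_geI) (auto simp: sums_iff)
    then have "0 < conv_radius a" by (rule less_le_trans[rotated]) simp
    then show "0 < fps_conv_radius (Abs_fps a)" by (simp add: fps_conv_radius_def)
    have "eventually (\<lambda>z. z \<in> ball 0 1) (nhds (0::complex))"
      by (intro eventually_nhds_in_open) auto
    then show "eventually (\<lambda>z. eval_fps (Abs_fps a) z = f z) (nhds 0)"
      by eventually_elim (use assms in \<open>auto simp: eval_fps_def sums_iff\<close>)
  qed
  from fps_nth_fps_expansion[OF this, of n] show ?thesis by (simp add: taylor_coeff_def)
qed

lemma holomorphic_on_ball_sums:
  assumes "\<And>z. cmod z < 1 \<Longrightarrow> (\<lambda>n. a n * z ^ n) sums f z"
  shows "f holomorphic_on ball 0 1"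
  by (rule power_series_holomorphic[of 0 1 a]) (use assms in simp)

text \<open>Parseval on the full disk: monotone convergence over an exhaustion by smaller balls,
  then over the terms of the series. Extended nonnegative values include the case where both sides
  are infinite, as the characterization of membership requires.\<close>

lemma nn_integral_weighted_area_square:
  assumes \<alpha>: "-1 < \<alpha>" and f: "f holomorphic_on ball 0 1"
  shows "(\<integral>\<^sup>+z. ennreal ((cmod (f z))\<^sup>2) \<partial>weighted_area \<alpha>)
       = (\<Sum>n. ennreal ((cmod (taylor_coeff f n))\<^sup>2 * bergman_weight ((\<alpha> + 2) / 2) n))"
proof -
  let ?a = "taylor_coeff f"
  \<comment> \<open>\<open>f\<close> is arbitrary off the disk; cutting it off gives a Borel
    function on the plane.\<close>
  define F where "F z = indicator (ball 0 1) z *\<^sub>R f z" for z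
  define g where "g z = ennreal ((cmod (F z))\<^sup>2)" for z
  define h where "h z = (\<Sum>n. ennreal ((cmod (?a n))\<^sup>2 * cmod z ^ (2 * n)))" for z
  have [measurable]: "F \<in> borel_measurable borel"
    unfolding F_def[abs_def] using f
    by (intro borel_measurable_continuous_on_indicator holomorphic_on_imp_continuous_on) auto
  have [measurable]: "g \<in> borel_measurable borel" "h \<in> borel_measurable borel"
    unfolding g_def[abs_def] h_def[abs_def] by measurable
  \<comment> \<open>The shift by 2 keeps all radii positive, beginning with 1/2.\<close>
  define B where "B i = ball (0::complex) (1 - 1 / (real i + 2))" for i :: nat
  have B1: "(\<Union>i. B i) = ball 0 1"
  proof (intro equalityI subsetI)
    fix z assume "z \<in> (\<Union>i. B i)"
    then obtain i where "cmod z < 1 - 1 / (real i + 2)" by (auto simp: B_def)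
    moreover have "1 / (real i + 2) > 0" by simp
    ultimately have "cmod z < 1" by linarith
    then show "z \<in> ball 0 1" by simp
  next
    fix z :: complex assume "z \<in> ball 0 1"
    then have "0 < 1 - cmod z" by simp
    then obtain i where i: "inverse (real (Suc i)) < 1 - cmod z" using reals_Archimedean by blast
    have "1 / (real i + 2) \<le> inverse (real (Suc i))" by (simp add: field_simps)
    then show "z \<in> (\<Union>i. B i)" using i by (auto simp: B_def intro!: exI[of _ i])
  qed
  have inc: "incseq B"
    unfolding B_def by (intro incseq_SucI subset_ball) (simp add: field_simps)
  have Bs: "range B \<subseteq> sets borel" by (auto simp: B_def)
  have eqB: "(\<integral>\<^sup>+z. g z * indicator (B i) z \<partial>disk_measure \<alpha>) = (\<integral>\<^sup>+z. h z * indicator (B i) z \<partial>disk_measure \<alpha>)" for i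
  proof -
    define R where "R = 1 - 1 / (real i + 2)"
    have R: "0 < R" "R < 1" by (auto simp: R_def field_simps)
    \<comment> \<open>Convergence at the midpoint of \<open>R\<close> and 1 yields absolute
      convergence at \<open>R\<close>.\<close>
    have "summable (\<lambda>n. ?a n * (of_real ((R + 1) / 2)) ^ n)"
    proof (rule sums_summable[OF taylor_coeff_sums[OF f]])
      show "cmod (of_real ((R + 1) / 2)) < 1" using R by (simp only: norm_of_real) simp
    qed
    then have "summable (\<lambda>n. norm (?a n * (of_real R) ^ n))"
    proof (rule powser_insidea)
      show "cmod (of_real R) < cmod (of_real ((R + 1) / 2))" using R by (simp only: norm_of_real) simp
    qed
    then have sm: "summable (\<lambda>n. cmod (?a n) * R ^ n)" using R by (simp add: norm_mult norm_power)
    have "(\<integral>\<^sup>+z. g z * indicator (B i) z \<partial>disk_measure \<alpha>)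
        = (\<integral>\<^sup>+z. ennreal ((cmod (\<Sum>n. ?a n * z ^ n))\<^sup>2) * indicator (ball 0 R) z \<partial>disk_measure \<alpha>)"
    proof (rule nn_integral_cong)
      fix z
      show "g z * indicator (B i) z = ennreal ((cmod (\<Sum>n. ?a n * z ^ n))\<^sup>2) * indicator (ball 0 R) z"
      proof (cases "cmod z < R")
        case True
        then have "F z = (\<Sum>n. ?a n * z ^ n)"
          using R taylor_coeff_sums[OF f, of z] by (simp add: F_def sums_iff)
        then show ?thesis by (simp add: g_def B_def R_def)
      next
        case False
        then show ?thesis by (simp add: B_def R_def)
      qed
    qed
    also have "\<dots> = (\<integral>\<^sup>+z. h z * indicator (B i) z \<partial>disk_measure \<alpha>)"
      unfolding h_def B_def R_def[symmetric]
      by (rule nn_integral_disk_measure_power_series_ball[OF \<alpha> R(1) sm])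
    finally show ?thesis .
  qed
  have "emeasure (density (disk_measure \<alpha>) g) (ball 0 1) = (SUP i. emeasure (density (disk_measure \<alpha>) g) (B i))"
    unfolding B1[symmetric] by (rule SUP_emeasure_incseq[symmetric]) (use inc Bs in auto)
  also have "\<dots> = (SUP i. emeasure (density (disk_measure \<alpha>) h) (B i))"
  proof (intro SUP_cong refl)
    fix i
    have Bi: "B i \<in> sets (disk_measure \<alpha>)" by (simp add: B_def)
    have gm: "g \<in> borel_measurable (disk_measure \<alpha>)" and hm: "h \<in> borel_measurable (disk_measure \<alpha>)"
      by measurable
    show "emeasure (density (disk_measure \<alpha>) g) (B i) = emeasure (density (disk_measure \<alpha>) h) (B i)"
      by (simp only: emeasure_density[OF gm Bi] emeasure_density[OF hm Bi] eqB)
  qed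
  also have "\<dots> = emeasure (density (disk_measure \<alpha>) h) (ball 0 1)"
    unfolding B1[symmetric] by (rule SUP_emeasure_incseq) (use inc Bs in auto)
  finally have eq: "(\<integral>\<^sup>+z. g z * indicator (ball 0 1) z \<partial>disk_measure \<alpha>) = (\<integral>\<^sup>+z. h z * indicator (ball 0 1) z \<partial>disk_measure \<alpha>)"
    by (simp add: emeasure_density)
  have indm: "(indicator (ball 0 1) :: complex \<Rightarrow> ennreal) \<in> borel_measurable borel"
    by (intro borel_measurable_indicator) auto
  have to_disk: "(\<integral>\<^sup>+z. k z \<partial>weighted_area \<alpha>) = (\<integral>\<^sup>+z. k z * indicator (ball 0 1) z \<partial>disk_measure \<alpha>)"
    if [measurable]: "k \<in> borel_measurable borel" for k
  proof -
    have "(\<integral>\<^sup>+z. k z \<partial>weighted_area \<alpha>) = (\<integral>\<^sup>+z. k z * indicator (ball 0 1) z \<partial>weighted_area \<alpha>)"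
      by (intro nn_integral_cong) (simp add: space_weighted_area)
    also have "\<dots> = (\<integral>\<^sup>+z. k z * indicator (ball 0 1) z \<partial>disk_measure \<alpha>)"
      by (rule nn_integral_weighted_area[OF \<alpha>]) (intro borel_measurable_times_ennreal that indm)
    finally show ?thesis .
  qed
  have "(\<integral>\<^sup>+z. ennreal ((cmod (f z))\<^sup>2) \<partial>weighted_area \<alpha>) = (\<integral>\<^sup>+z. g z \<partial>weighted_area \<alpha>)"
    by (intro nn_integral_cong) (simp add: space_weighted_area g_def F_def)
  also have "\<dots> = (\<integral>\<^sup>+z. h z * indicator (ball 0 1) z \<partial>disk_measure \<alpha>)"
    by (subst to_disk) (simp_all add: eq)
  also have "\<dots> = (\<integral>\<^sup>+z. h z \<partial>weighted_area \<alpha>)"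
    by (subst to_disk) simp_all
  also have "\<dots> = (\<integral>\<^sup>+z. h z \<partial>disk_measure \<alpha>)"
    by (rule nn_integral_weighted_area[OF \<alpha>]) simp
  also have "\<dots> = (\<Sum>n. \<integral>\<^sup>+z. ennreal ((cmod (?a n))\<^sup>2 * cmod z ^ (2 * n)) \<partial>disk_measure \<alpha>)"
    unfolding h_def by (rule nn_integral_suminf) measurable
  also have "\<dots> = (\<Sum>n. ennreal ((cmod (?a n))\<^sup>2 * bergman_weight ((\<alpha> + 2) / 2) n))"
  proof (rule arg_cong[where f = suminf], rule ext)
    fix n
    have "(\<integral>\<^sup>+z. ennreal ((cmod (?a n))\<^sup>2 * cmod z ^ (2 * n)) \<partial>disk_measure \<alpha>)
        = ennreal ((cmod (?a n))\<^sup>2) * (\<integral>\<^sup>+z. ennreal (cmod z ^ (2 * n)) \<partial>disk_measure \<alpha>)"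
      by (simp add: ennreal_mult nn_integral_cmult)
    also have "\<dots> = ennreal ((cmod (?a n))\<^sup>2 * bergman_weight ((\<alpha> + 2) / 2) n)"
      unfolding nn_integral_disk_measure_power[OF \<alpha>]
      using bergman_weight_pos[of "(\<alpha> + 2) / 2" n] \<alpha> by (simp add: ennreal_mult)
    finally show "(\<integral>\<^sup>+z. ennreal ((cmod (?a n))\<^sup>2 * cmod z ^ (2 * n)) \<partial>disk_measure \<alpha>) = \<dots>" .
  qed
  finally show ?thesis .
qed

lemma borel_measurable_weighted_area_holomorphic:
  assumes "f holomorphic_on ball 0 1"
  shows "f \<in> borel_measurable (weighted_area \<alpha>)"
  unfolding measurable_cong_sets[OF sets_weighted_area refl]
  by (intro borel_measurable_continuous_on_restrict holomorphic_on_imp_continuous_on assms)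

lemma bergman_space_2_iff:
  assumes \<alpha>: "-1 < \<alpha>"
  shows "f \<in> bergman_space 2 \<alpha> \<longleftrightarrow> f holomorphic_on ball 0 1 \<and>
    summable (\<lambda>n. (cmod (taylor_coeff f n))\<^sup>2 * bergman_weight ((\<alpha> + 2) / 2) n)"
proof (cases "f holomorphic_on ball 0 1")
  case True
  have [measurable]: "f \<in> borel_measurable (weighted_area \<alpha>)"
    using True by (rule borel_measurable_weighted_area_holomorphic)
  let ?t = "\<lambda>n. (cmod (taylor_coeff f n))\<^sup>2 * bergman_weight ((\<alpha> + 2) / 2) n"
  have nn: "0 \<le> ?t n" for n using bergman_weight_pos[of "(\<alpha> + 2) / 2" n] \<alpha> by simp
  have "integrable (weighted_area \<alpha>) (\<lambda>z. cmod (f z) powr 2) \<longleftrightarrow> (\<Sum>n. ennreal (?t n)) < \<infinity>"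
    unfolding integrable_iff_bounded nn_integral_weighted_area_square[OF \<alpha> True, symmetric]
    by simp
  also have "\<dots> \<longleftrightarrow> summable ?t"
  proof
    assume "(\<Sum>n. ennreal (?t n)) < \<infinity>"
    then have "(\<Sum>n. ennreal (?t n)) \<noteq> top" by (simp only: infinity_ennreal_def less_top)
    then show "summable ?t" by (rule summable_suminf_not_top[OF nn])
  next
    assume sm: "summable ?t"
    show "(\<Sum>n. ennreal (?t n)) < \<infinity>"
      unfolding suminf_ennreal2[OF nn sm] by simp
  qed
  finally show ?thesis using True by (simp add: bergman_space_def)
qed (simp add: bergman_space_def)

lemma bergman_norm_2:
  assumes \<alpha>: "-1 < \<alpha>" and f: "f \<in> bergman_space 2 \<alpha>"
  shows "bergman_norm 2 \<alpha> f = sqrt (\<Sum>n. (cmod (taylor_coeff f n))\<^sup>2 * bergman_weight ((\<alpha> + 2) / 2) n)"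
proof -
  let ?t = "\<lambda>n. (cmod (taylor_coeff f n))\<^sup>2 * bergman_weight ((\<alpha> + 2) / 2) n"
  have nn: "0 \<le> ?t n" for n using bergman_weight_pos[of "(\<alpha> + 2) / 2" n] \<alpha> by simp
  have hol: "f holomorphic_on ball 0 1" and sm: "summable ?t"
    using f bergman_space_2_iff[OF \<alpha>] by auto
  have [measurable]: "f \<in> borel_measurable (weighted_area \<alpha>)"
    using hol by (rule borel_measurable_weighted_area_holomorphic)
  have "(LINT z|weighted_area \<alpha>. cmod (f z) powr 2)
      = enn2real (\<integral>\<^sup>+z. ennreal ((cmod (f z))\<^sup>2) \<partial>weighted_area \<alpha>)"
    by (subst integral_eq_nn_integral) simp_all
  also have "\<dots> = enn2real (ennreal (suminf ?t))"
    by (simp only: nn_integral_weighted_area_square[OF \<alpha> hol] suminf_ennreal2[OF nn sm])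
  also have "\<dots> = suminf ?t" using suminf_nonneg[OF sm nn] by simp
  finally show ?thesis
    using suminf_nonneg[OF sm nn] by (simp add: bergman_norm_def powr_half_sqrt)
qed

lemma bergman_norm_cong:
  assumes "\<And>z. cmod z < 1 \<Longrightarrow> f z = g z"
  shows "bergman_norm p \<alpha> f = bergman_norm p \<alpha> g"
  unfolding bergman_norm_def
  by (intro arg_cong[where f = "\<lambda>x. x powr _"] Bochner_Integration.integral_cong)
     (use assms in \<open>auto simp: space_weighted_area\<close>)

lemma bergman_norm_nonneg: "0 \<le> bergman_norm p \<alpha> f"
  by (simp add: bergman_norm_def)

lemma bergman_norm_2_scale: "bergman_norm 2 \<alpha> (\<lambda>z. c * f z) = cmod c * bergman_norm 2 \<alpha> f"
  by (simp add: bergman_norm_def norm_mult power_mult_distrib powr_half_sqrt real_sqrt_mult)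

lemma bergman_space_2_scale:
  assumes "f \<in> bergman_space 2 \<alpha>"
  shows "(\<lambda>z. c * f z) \<in> bergman_space 2 \<alpha>"
  using assms by (auto simp: bergman_space_def norm_mult power_mult_distrib intro!: holomorphic_intros)

section \<open>Convergence of power series and infinite sections\<close>

lemma bergman_weight_ge:
  assumes "1 / 2 \<le> s" "s < 1"
  shows "Gamma (2 * s) / (real n + 1) \<le> bergman_weight s n"
proof -
  have G: "Gamma (2 * s) > 0" "Gamma (real n + 2 * s) > 0" using assms by (auto intro!: Gamma_real_pos)
  have "real n + 2 * s = (real n + 1) + (2 * s - 1)" by simp
  then have "Gamma (real n + 2 * s) \<le> Gamma (real n + 1) * (real n + 1) powr (2 * s - 1)"
    by (simp only:) (rule Gamma_add_le, use assms in auto)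
  also have "\<dots> \<le> Gamma (real n + 1) * (real n + 1) powr 1"
    using assms by (intro mult_left_mono powr_mono) (auto simp: Gamma_real_pos less_imp_le)
  also have "\<dots> = fact n * (real n + 1)" by (simp add: Gamma_fact add_ac)
  finally have "1 / (real n + 1) \<le> fact n / Gamma (real n + 2 * s)"
    using G by (simp add: field_simps)
  then have "Gamma (2 * s) * (1 / (real n + 1)) \<le> Gamma (2 * s) * (fact n / Gamma (real n + 2 * s))"
    using G by (intro mult_left_mono) auto
  then show ?thesis by (simp add: bergman_weight_def)
qed

text \<open>Each term is split by x y \<le> x^2 + y^2 into the weighted square of the coefficient
  and |z|^(2 n) divided by the weight. By \<open>bergman_weight_ge\<close> the reciprocal weight
  grows at most linearly, so the second part is summable.\<close>

lemma summable_power_series_bergman: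
  assumes s: "1 / 2 \<le> s" "s < 1" and sm: "summable (\<lambda>n. (cmod (a n))\<^sup>2 * bergman_weight s n)"
    and z: "cmod z < 1"
  shows "summable (\<lambda>n. a n * z ^ n)"
proof (rule summable_comparison_test')
  define G where "G = Gamma (2 * s)"
  have G: "G > 0" using s by (auto simp: G_def intro!: Gamma_real_pos)
  have "summable (\<lambda>n. of_nat (Suc n) * ((cmod z)\<^sup>2) ^ n)"
    using z by (intro sums_summable[OF geometric_deriv_sums]) (simp add: abs_square_less_1)
  then show "summable (\<lambda>n. (cmod (a n))\<^sup>2 * bergman_weight s n + inverse G * (of_nat (Suc n) * ((cmod z)\<^sup>2) ^ n))"
    by (intro summable_add sm summable_mult)
  fix n
  let ?w = "bergman_weight s n"
  have w: "?w > 0" using s by (simp add: bergman_weight_pos)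
  have "inverse ?w \<le> inverse (G / (real n + 1))"
    using bergman_weight_ge[OF s, of n] G by (intro le_imp_inverse_le) (auto simp: G_def)
  then have inv: "inverse ?w \<le> inverse G * of_nat (Suc n)" by (simp add: field_simps)
  define x y where "x = cmod (a n) * sqrt ?w" and "y = cmod z ^ n / sqrt ?w"
  have "cmod (a n * z ^ n) = x * y" using w by (simp add: x_def y_def norm_mult norm_power)
  also have "\<dots> \<le> x\<^sup>2 + y\<^sup>2"
  proof -
    have "0 \<le> (x - y)\<^sup>2 + x\<^sup>2 + y\<^sup>2" by simp
    then show ?thesis by (simp add: power2_eq_square algebra_simps)
  qed
  also have "x\<^sup>2 = (cmod (a n))\<^sup>2 * ?w" using w by (simp add: x_def power_mult_distrib)
  also have "y\<^sup>2 = inverse ?w * ((cmod z)\<^sup>2) ^ n"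
    using w by (simp add: y_def power_divide field_simps flip: power_mult)
  also have "\<dots> \<le> (inverse G * of_nat (Suc n)) * ((cmod z)\<^sup>2) ^ n"
    using inv by (intro mult_right_mono) auto
  finally show "cmod (a n * z ^ n)
      \<le> (cmod (a n))\<^sup>2 * ?w + inverse G * (of_nat (Suc n) * ((cmod z)\<^sup>2) ^ n)" by (simp add: mult_ac)
qed

text \<open>The limit of the finite sections. The bound itself yields convergence of a row: its
  partial sums have nonnegative terms, and one summand of the weighted total already controls
  them.\<close>

lemma hilbert_matrix_bounded:
  fixes A :: "nat \<Rightarrow> real"
  assumes s: "1 / 2 \<le> s" "s < 1" and A: "\<And>k. 0 \<le> A k"
    and sm: "summable (\<lambda>k. (A k)\<^sup>2 * bergman_weight s k)"
  shows "summable (\<lambda>k. A k / (real n + real k + 1))"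
    and "(\<Sum>n<N. bergman_weight s n * (\<Sum>k. A k / (real n + real k + 1))\<^sup>2)
           \<le> (Gamma s * Gamma (1 - s))\<^sup>2 * (\<Sum>k. (A k)\<^sup>2 * bergman_weight s k)"
proof -
  let ?w = "bergman_weight s"
  let ?C = "Gamma s * Gamma (1 - s)"
  define S where "S = (\<Sum>k. (A k)\<^sup>2 * ?w k)"
  have w: "?w n > 0" for n using s by (simp add: bergman_weight_pos)
  have part: "(\<Sum>n<N. ?w n * (\<Sum>k<K. A k / (real n + real k + 1))\<^sup>2) \<le> ?C\<^sup>2 * S" for N K
  proof -
    have "(\<Sum>k<K. (A k)\<^sup>2 * ?w k) \<le> S"
      unfolding S_def by (rule sum_le_suminf[OF sm]) (use w in \<open>auto simp: less_imp_le\<close>)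
    then show ?thesis
      using hilbert_matrix_upper_bound[OF s, where A = A and N = N and K = K]
      by (meson mult_left_mono order_trans zero_le_power2)
  qed
  show smr: "summable (\<lambda>k. A k / (real n + real k + 1))" for n
  proof (rule summableI_nonneg_bounded)
    fix K
    let ?r = "\<Sum>k<K. A k / (real n + real k + 1)"
    have "?w n * ?r\<^sup>2 \<le> (\<Sum>m<Suc n. ?w m * (\<Sum>k<K. A k / (real m + real k + 1))\<^sup>2)"
      using w by (intro member_le_sum) (auto simp: less_imp_le)
    also have "\<dots> \<le> ?C\<^sup>2 * S" by (rule part)
    finally have "?r\<^sup>2 \<le> ?C\<^sup>2 * S / ?w n" using w[of n] by (simp add: pos_le_divide_eq mult.commute)
    then show "?r \<le> sqrt (?C\<^sup>2 * S / ?w n)" by (rule real_le_rsqrt)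
  qed (use A in simp)
  have "(\<lambda>K. \<Sum>n<N. ?w n * (\<Sum>k<K. A k / (real n + real k + 1))\<^sup>2)
      \<longlonglongrightarrow> (\<Sum>n<N. ?w n * (\<Sum>k. A k / (real n + real k + 1))\<^sup>2)"
    by (intro tendsto_intros summable_LIMSEQ smr)
  then show "(\<Sum>n<N. ?w n * (\<Sum>k. A k / (real n + real k + 1))\<^sup>2) \<le> ?C\<^sup>2 * (\<Sum>k. (A k)\<^sup>2 * ?w k)"
    using part unfolding S_def by (intro LIMSEQ_le_const2) auto
qed

section \<open>The Hilbert matrix operator\<close>


definition hilbert_coeff :: "(nat \<Rightarrow> complex) \<Rightarrow> nat \<Rightarrow> complex" where
  "hilbert_coeff a n = (\<Sum>k. a k / of_nat (n + k + 1))"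

lemma norm_divide_hilbert: "norm (a / of_nat (n + k + 1) :: complex) = norm a / (real n + real k + 1)"
proof -
  have "norm (of_nat (n + k + 1) :: complex) = real n + real k + 1"
    unfolding norm_of_nat by simp
  then show ?thesis by (simp only: norm_divide)
qed

context
  fixes s :: real and a :: "nat \<Rightarrow> complex"
  assumes s: "1 / 2 \<le> s" "s < 1"
    and sm: "summable (\<lambda>k. (cmod (a k))\<^sup>2 * bergman_weight s k)"
begin

lemma summable_hilbert_coeff: "summable (\<lambda>k. a k / of_nat (n + k + 1))"
proof (rule summable_norm_cancel)
  show "summable (\<lambda>k. norm (a k / of_nat (n + k + 1)))"
    unfolding norm_divide_hilbert by (rule hilbert_matrix_bounded(1)[OF s _ sm]) simp
qed

text \<open>The triangle inequality reduces the complex case to the sequence of moduli.\<close>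

lemma
  shows summable_hilbert_coeff_square: "summable (\<lambda>n. (cmod (hilbert_coeff a n))\<^sup>2 * bergman_weight s n)"
    and suminf_hilbert_coeff_square_le:
      "(\<Sum>n. (cmod (hilbert_coeff a n))\<^sup>2 * bergman_weight s n)
         \<le> (Gamma s * Gamma (1 - s))\<^sup>2 * (\<Sum>k. (cmod (a k))\<^sup>2 * bergman_weight s k)"
proof -
  let ?w = "bergman_weight s"
  have w: "?w n > 0" for n using s by (simp add: bergman_weight_pos)
  have le: "cmod (hilbert_coeff a n) \<le> (\<Sum>k. cmod (a k) / (real n + real k + 1))" for n
    unfolding hilbert_coeff_def norm_divide_hilbert[symmetric]
  proof (rule summable_norm)
    show "summable (\<lambda>k. norm (a k / of_nat (n + k + 1)))"
      unfolding norm_divide_hilbert by (rule hilbert_matrix_bounded(1)[OF s _ sm]) simp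
  qed
  have part: "(\<Sum>n<N. (cmod (hilbert_coeff a n))\<^sup>2 * ?w n)
      \<le> (Gamma s * Gamma (1 - s))\<^sup>2 * (\<Sum>k. (cmod (a k))\<^sup>2 * ?w k)" for N
  proof -
    have "(\<Sum>n<N. (cmod (hilbert_coeff a n))\<^sup>2 * ?w n)
        \<le> (\<Sum>n<N. ?w n * (\<Sum>k. cmod (a k) / (real n + real k + 1))\<^sup>2)"
    proof (rule sum_mono)
      fix n
      have "(cmod (hilbert_coeff a n))\<^sup>2 \<le> (\<Sum>k. cmod (a k) / (real n + real k + 1))\<^sup>2"
        using le by (intro power_mono) auto
      then show "(cmod (hilbert_coeff a n))\<^sup>2 * ?w n \<le> ?w n * (\<Sum>k. cmod (a k) / (real n + real k + 1))\<^sup>2"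
        using w[of n] by (simp add: mult.commute)
    qed
    also have "\<dots> \<le> (Gamma s * Gamma (1 - s))\<^sup>2 * (\<Sum>k. (cmod (a k))\<^sup>2 * ?w k)"
      by (rule hilbert_matrix_bounded(2)[OF s _ sm]) simp
    finally show ?thesis .
  qed
  show sm': "summable (\<lambda>n. (cmod (hilbert_coeff a n))\<^sup>2 * ?w n)"
    by (rule summableI_nonneg_bounded[OF _ part]) (use w in \<open>simp add: less_imp_le\<close>)
  show "(\<Sum>n. (cmod (hilbert_coeff a n))\<^sup>2 * ?w n)
      \<le> (Gamma s * Gamma (1 - s))\<^sup>2 * (\<Sum>k. (cmod (a k))\<^sup>2 * ?w k)"
    by (rule suminf_le_const[OF sm' part])
qed

end

lemma Gamma_reflection_real: "Gamma (x :: real) * Gamma (1 - x) = pi / sin (pi * x)"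
proof -
  have "complex_of_real (Gamma x * Gamma (1 - x)) = Gamma (of_real x) * Gamma (1 - of_real x)"
    by (simp flip: Gamma_complex_of_real)
  also have "\<dots> = of_real (pi / sin (pi * x))"
    by (simp add: Gamma_reflection_complex sin_of_real flip: of_real_mult)
  finally show ?thesis by (simp only: of_real_eq_iff)
qed

section \<open>Boundedness and norm of the operator\<close>

context
  fixes \<alpha> s :: real
  assumes \<alpha>: "-1 < \<alpha>" "\<alpha> < 0" and s_def: "s = (\<alpha> + 2) / 2"
begin

lemma index_bounds: "1 / 2 \<le> s" "s < 1" using \<alpha> by (auto simp: s_def)

lemma bergman_coeff_summable:
  assumes "f \<in> bergman_space 2 \<alpha>"
  shows "summable (\<lambda>k. (cmod (taylor_coeff f k))\<^sup>2 * bergman_weight s k)"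
  using assms bergman_space_2_iff[OF \<alpha>(1)] by (simp add: s_def)

text \<open>The way back from sequences to functions, used both for images under the operator and
  for test functions. The values that the series formula assigns off the disk are
  irrelevant.\<close>

lemma power_series_in_bergman_space:
  assumes sm: "summable (\<lambda>k. (cmod (a k))\<^sup>2 * bergman_weight s k)"
    and f: "\<And>z. f z = (\<Sum>n. a n * z ^ n)"
  shows "f \<in> bergman_space 2 \<alpha>" "taylor_coeff f n = a n"
    "cmod z < 1 \<Longrightarrow> (\<lambda>n. a n * z ^ n) sums f z"
proof -
  have sums: "(\<lambda>n. a n * z ^ n) sums f z" if "cmod z < 1" for z
    using summable_power_series_bergman[OF index_bounds sm that] by (simp add: f summable_sums)
  then show tc: "taylor_coeff f n = a n" for n by (rule taylor_coeff_eqI)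
  show "f \<in> bergman_space 2 \<alpha>"
    using sm holomorphic_on_ball_sums[OF sums]
    by (simp add: bergman_space_2_iff[OF \<alpha>(1)] tc s_def)
  show "cmod z < 1 \<Longrightarrow> (\<lambda>n. a n * z ^ n) sums f z" by (rule sums)
qed

lemma hilbert_matrix_op_in_bergman_space:
  assumes f: "f \<in> bergman_space 2 \<alpha>"
  shows "hilbert_matrix_op f \<in> bergman_space 2 \<alpha>"
    "taylor_coeff (hilbert_matrix_op f) n = hilbert_coeff (taylor_coeff f) n"
    "cmod z < 1 \<Longrightarrow> (\<lambda>n. hilbert_coeff (taylor_coeff f) n * z ^ n) sums hilbert_matrix_op f z"
proof -
  have "hilbert_matrix_op f z = (\<Sum>n. hilbert_coeff (taylor_coeff f) n * z ^ n)" for z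
    by (simp only: hilbert_matrix_op_def hilbert_coeff_def)
  note * = power_series_in_bergman_space
    [OF summable_hilbert_coeff_square[OF index_bounds bergman_coeff_summable[OF f]] this]
  show "hilbert_matrix_op f \<in> bergman_space 2 \<alpha>" by (rule *(1))
  show "taylor_coeff (hilbert_matrix_op f) n = hilbert_coeff (taylor_coeff f) n" by (rule *(2))
  show "cmod z < 1 \<Longrightarrow> (\<lambda>n. hilbert_coeff (taylor_coeff f) n * z ^ n) sums hilbert_matrix_op f z"
    by (rule *(3))
qed

lemma bergman_norm_hilbert_matrix_op_le:
  assumes f: "f \<in> bergman_space 2 \<alpha>"
  shows "bergman_norm 2 \<alpha> (hilbert_matrix_op f) \<le> Gamma s * Gamma (1 - s) * bergman_norm 2 \<alpha> f"
proof -
  have C: "Gamma s * Gamma (1 - s) \<ge> 0" using index_bounds by (simp add: Gamma_real_pos less_imp_le)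
  have "bergman_norm 2 \<alpha> (hilbert_matrix_op f)
      = sqrt (\<Sum>n. (cmod (hilbert_coeff (taylor_coeff f) n))\<^sup>2 * bergman_weight s n)"
    using hilbert_matrix_op_in_bergman_space[OF f] by (simp add: bergman_norm_2[OF \<alpha>(1)] s_def)
  also have "\<dots> \<le> sqrt ((Gamma s * Gamma (1 - s))\<^sup>2 * (\<Sum>k. (cmod (taylor_coeff f k))\<^sup>2 * bergman_weight s k))"
    by (intro real_sqrt_le_mono suminf_hilbert_coeff_square_le index_bounds bergman_coeff_summable f)
  also have "\<dots> = Gamma s * Gamma (1 - s) * bergman_norm 2 \<alpha> f"
    using C by (simp add: bergman_norm_2[OF \<alpha>(1) f] s_def real_sqrt_mult)
  finally show ?thesis .
qed

lemma hilbert_matrix_op_add: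
  assumes f: "f \<in> bergman_space 2 \<alpha>" and g: "g \<in> bergman_space 2 \<alpha>" and z: "cmod z < 1"
  shows "hilbert_matrix_op (\<lambda>w. f w + g w) z = hilbert_matrix_op f z + hilbert_matrix_op g z"
proof -
  have hol: "f holomorphic_on ball 0 1" "g holomorphic_on ball 0 1"
    using f g by (auto simp: bergman_space_def)
  have tc: "taylor_coeff (\<lambda>w. f w + g w) n = taylor_coeff f n + taylor_coeff g n" for n
    by (rule taylor_coeff_eqI) (auto simp: distrib_right intro!: sums_add taylor_coeff_sums hol)
  note smf = summable_hilbert_coeff[OF index_bounds bergman_coeff_summable[OF f]]
  note smg = summable_hilbert_coeff[OF index_bounds bergman_coeff_summable[OF g]]
  have hc: "hilbert_coeff (taylor_coeff (\<lambda>w. f w + g w)) n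
      = hilbert_coeff (taylor_coeff f) n + hilbert_coeff (taylor_coeff g) n" for n
    unfolding hilbert_coeff_def tc add_divide_distrib by (rule suminf_add[OF smf smg, symmetric])
  have "(\<lambda>n. hilbert_coeff (taylor_coeff (\<lambda>w. f w + g w)) n * z ^ n)
      sums (hilbert_matrix_op f z + hilbert_matrix_op g z)"
    unfolding hc distrib_right
    by (intro sums_add hilbert_matrix_op_in_bergman_space(3) f g z)
  then show ?thesis by (simp add: hilbert_matrix_op_def hilbert_coeff_def sums_iff)
qed

lemma hilbert_matrix_op_scale:
  assumes f: "f \<in> bergman_space 2 \<alpha>" and z: "cmod z < 1"
  shows "hilbert_matrix_op (\<lambda>w. c * f w) z = c * hilbert_matrix_op f z"
proof -
  have hol: "f holomorphic_on ball 0 1" using f by (auto simp: bergman_space_def)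
  have tc: "taylor_coeff (\<lambda>w. c * f w) n = c * taylor_coeff f n" for n
    by (rule taylor_coeff_eqI) (auto simp: mult.assoc intro!: sums_mult taylor_coeff_sums hol)
  note smf = summable_hilbert_coeff[OF index_bounds bergman_coeff_summable[OF f]]
  have hc: "hilbert_coeff (taylor_coeff (\<lambda>w. c * f w)) n = c * hilbert_coeff (taylor_coeff f) n" for n
    unfolding hilbert_coeff_def tc times_divide_eq_right[symmetric] by (rule suminf_mult[OF smf])
  have "(\<lambda>n. hilbert_coeff (taylor_coeff (\<lambda>w. c * f w)) n * z ^ n) sums (c * hilbert_matrix_op f z)"
    unfolding hc mult.assoc
    by (intro sums_mult hilbert_matrix_op_in_bergman_space(3) f z)
  then show ?thesis by (simp add: hilbert_matrix_op_def hilbert_coeff_def sums_iff)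
qed

lemma bounded_hilbert_matrix_op: "bounded_operator_on_bergman 2 \<alpha> hilbert_matrix_op"
  unfolding bounded_operator_on_bergman_def
  using hilbert_matrix_op_in_bergman_space(1) hilbert_matrix_op_add hilbert_matrix_op_scale
    bergman_norm_hilbert_matrix_op_le
  by (auto intro!: exI[of _ "Gamma s * Gamma (1 - s)"])

lemma bergman_opnorm_hilbert_matrix_op:
  "bergman_opnorm 2 \<alpha> hilbert_matrix_op = Gamma s * Gamma (1 - s)"
proof (rule antisym)
  let ?C = "Gamma s * Gamma (1 - s)" and ?U = "{f \<in> bergman_space 2 \<alpha>. bergman_norm 2 \<alpha> f \<le> 1}"
  let ?H = hilbert_matrix_op
  have C: "?C \<ge> 0" using index_bounds by (simp add: Gamma_real_pos less_imp_le)
  have ub: "bergman_norm 2 \<alpha> (?H f) \<le> ?C" if "f \<in> ?U" for f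
    using bergman_norm_hilbert_matrix_op_le[of f] that mult_left_mono[OF _ C, of "bergman_norm 2 \<alpha> f" 1] by auto
  \<comment> \<open>Makes the supremum range over a nonempty set and later gives
    \<open>0 \<le> M\<close>.\<close>
  have zero: "(\<lambda>_. 0) \<in> ?U" by (simp add: bergman_space_def bergman_norm_def)
  show "bergman_opnorm 2 \<alpha> ?H \<le> ?C"
    unfolding bergman_opnorm_def using zero ub by (intro cSUP_least) auto
  define M where "M = bergman_opnorm 2 \<alpha> ?H"
  have bdd: "bdd_above ((\<lambda>f. bergman_norm 2 \<alpha> (?H f)) ` ?U)"
    using ub by (auto intro!: bdd_aboveI)
  have M_upper: "bergman_norm 2 \<alpha> (?H f) \<le> M" if "f \<in> ?U" for f
    unfolding M_def bergman_opnorm_def by (rule cSUP_upper[OF that bdd])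
  have M0: "0 \<le> M" using M_upper[OF zero] bergman_norm_nonneg order_trans by blast
  \<comment> \<open>Homogeneity carries the supremum over the unit ball to all \<open>f\<close>.
    Norm 0 cannot be normalized and is settled by the upper estimate.\<close>
  have M_bound: "bergman_norm 2 \<alpha> (?H f) \<le> M * bergman_norm 2 \<alpha> f" if f: "f \<in> bergman_space 2 \<alpha>" for f
  proof (cases "bergman_norm 2 \<alpha> f = 0")
    case True
    then show ?thesis using bergman_norm_hilbert_matrix_op_le[OF f] by simp
  next
    case False
    define r where "r = bergman_norm 2 \<alpha> f"
    have r: "r > 0" using False bergman_norm_nonneg[of 2 \<alpha> f] by (simp add: r_def)
    define g where "g z = of_real (1 / r) * f z" for z
    have "g \<in> ?U"
      using bergman_space_2_scale[OF f, of "of_real (1 / r)"] bergman_norm_2_scale[of \<alpha> "of_real (1 / r)" f] r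
      by (simp add: g_def[abs_def] norm_divide flip: r_def)
    then have "bergman_norm 2 \<alpha> (?H g) \<le> M" by (rule M_upper)
    moreover have "bergman_norm 2 \<alpha> (?H g) = bergman_norm 2 \<alpha> (\<lambda>z. of_real (1 / r) * ?H f z)"
      unfolding g_def[abs_def] by (intro bergman_norm_cong hilbert_matrix_op_scale f)
    moreover have "\<dots> = bergman_norm 2 \<alpha> (?H f) / r"
      using r by (subst bergman_norm_2_scale) (simp add: norm_divide)
    ultimately show ?thesis using r by (simp add: r_def[symmetric] pos_divide_le_eq)
  qed
  have "?C \<le> M"
  \<comment> \<open>The required sequence inequality is \<open>M_bound\<close> for the power series
    with coefficients \<open>A\<close>, its left side being a partial sum of the squared norm of the
    image.\<close>
  proof (rule hilbert_matrix_lower_bound[OF index_bounds M0])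
    fix A :: "nat \<Rightarrow> real" and N
    assume A: "\<And>k. 0 \<le> A k" and sm: "summable (\<lambda>k. (A k)\<^sup>2 * bergman_weight s k)"
    let ?a = "\<lambda>k. complex_of_real (A k)"
    define f where "f z = (\<Sum>n. ?a n * z ^ n)" for z
    have sm': "summable (\<lambda>k. (cmod (?a k))\<^sup>2 * bergman_weight s k)" using sm by simp
    note f = power_series_in_bergman_space[OF sm' f_def]
    have hc: "hilbert_coeff (taylor_coeff f) n = of_real (\<Sum>k. A k / (real n + real k + 1))" for n
    proof -
      have "summable (\<lambda>k. A k / (real n + real k + 1))"
        by (rule hilbert_matrix_bounded(1)[OF index_bounds A sm])
      then have "of_real (\<Sum>k. A k / (real n + real k + 1)) = (\<Sum>k. of_real (A k / (real n + real k + 1)) :: complex)"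
        by (rule suminf_of_real)
      also have "\<dots> = hilbert_coeff (taylor_coeff f) n"
        unfolding hilbert_coeff_def f(2) by (intro suminf_cong) (simp add: add_ac)
      finally show ?thesis ..
    qed
    let ?t = "\<lambda>n. (cmod (hilbert_coeff (taylor_coeff f) n))\<^sup>2 * bergman_weight s n"
    have smt: "summable ?t"
      by (rule summable_hilbert_coeff_square[OF index_bounds bergman_coeff_summable[OF f(1)]])
    have tn: "0 \<le> ?t n" for n using bergman_weight_pos[of s n] index_bounds by simp
    have "(\<Sum>n<N. bergman_weight s n * (\<Sum>k. A k / (real n + real k + 1))\<^sup>2) = (\<Sum>n<N. ?t n)"
      unfolding hc norm_of_real power2_abs by (simp only: mult.commute)
    also have "\<dots> \<le> suminf ?t" using smt tn by (intro sum_le_suminf) auto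
    also have "suminf ?t = (bergman_norm 2 \<alpha> (?H f))\<^sup>2"
      using hilbert_matrix_op_in_bergman_space[OF f(1)] suminf_nonneg[OF smt tn]
      by (simp add: bergman_norm_2[OF \<alpha>(1)] s_def)
    also have "\<dots> \<le> (M * bergman_norm 2 \<alpha> f)\<^sup>2"
      by (intro power_mono M_bound f(1) bergman_norm_nonneg)
    also have "\<dots> = M\<^sup>2 * (\<Sum>k. (A k)\<^sup>2 * bergman_weight s k)"
    proof -
      have "0 \<le> (\<Sum>k. (A k)\<^sup>2 * bergman_weight s k)"
        using bergman_weight_pos[of s] index_bounds by (intro suminf_nonneg sm) (auto simp: less_imp_le)
      then show ?thesis
        using bergman_norm_2[OF \<alpha>(1) f(1)] by (simp add: f(2) power_mult_distrib s_def)
    qed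
    finally show "(\<Sum>n<N. bergman_weight s n * (\<Sum>k. A k / (real n + real k + 1))\<^sup>2)
        \<le> M\<^sup>2 * (\<Sum>k. (A k)\<^sup>2 * bergman_weight s k)" .
  qed
  then show "?C \<le> bergman_opnorm 2 \<alpha> ?H" by (simp only: M_def)
qed

end

theorem theorem1p2:
  fixes \<alpha> :: real
  assumes "-1 < \<alpha>" and "\<alpha> < 0"
  shows "bounded_operator_on_bergman 2 \<alpha> hilbert_matrix_op \<and>
         bergman_opnorm 2 \<alpha> hilbert_matrix_op = Beta ((\<alpha> + 2) / 2) (1 - (\<alpha> + 2) / 2) \<and>
         Beta ((\<alpha> + 2) / 2) (1 - (\<alpha> + 2) / 2) = pi / sin ((\<alpha> + 2) * pi / 2)"
proof -
  let ?s = "(\<alpha> + 2) / 2"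
  have beta: "Beta ?s (1 - ?s) = Gamma ?s * Gamma (1 - ?s)"
    by (simp only: Beta_def) simp
  moreover have "pi * ?s = (\<alpha> + 2) * pi / 2" by simp
  ultimately show ?thesis
    using bounded_hilbert_matrix_op[OF assms refl] bergman_opnorm_hilbert_matrix_op[OF assms refl]
      Gamma_reflection_real[of ?s] by (simp only: simp_thms)
qed

end
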